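(* Let $\beta>1$ and let $\Sigma_A\subset S_\beta$ be a subshift of finite type such that there is a finite word $i_0\dots i_n$ which occurs in $S_\beta$ but does not occur in $\Sigma_A$. Then there exists $\alpha>0$ such that the set \[ G_{f_\beta}(\pi_\beta(\Sigma_A))=\Big\{\, y\in[0,1) : \pi_\beta(\Sigma_A)\cap\overline{\bigcup_{n=0}^\infty \{f_\beta^n(y)\}}=\emptyset \,\Big\} \] is $\alpha$-winning.
   Context: For $\beta>1$ let $f_\beta(x)=\beta x \pmod 1$ and, for $x\in[0,1]$, let $d(x,\beta)=(d(x,\beta)_n)_{n=0}^\infty$ with $d(x,\beta)_n=[\beta f_\beta^n(x)]$, where $[\cdot]$ is the integer part. The $\beta$-shift $S_\beta$ is the closure, in the product topology on sequences of non-negative integer digits, of $\{d(x,\beta): x\in[0,1)\}$. The map $\pi_\beta$ is given by $\pi_\beta((i_k)_{k=0}^\infty)=\sum_{k=0}^\infty i_k\beta^{-(k+1)}$. A finite word occurs in a set of sequences if it appears as a block of consecutive digits in some sequence of that set. A subshift of finite type is a set of all sequences over a finite alphabet avoiding a given finite collection of finite words. Game. Given $E\subset[0,1]$ and parameters $0<\alpha,\gamma<1$, two players Black and White play as follows. Initially Black chooses a closed interval $B_0\subset[0,1]$ (of positive length). Then, for $k=0,1,2,\dots$, White chooses a closed interval $W_k\subset B_k$ with $|W_k|\ge\alpha|B_k|$, and then Black chooses a closed interval $B_{k+1}\subset W_k$ with $|B_{k+1}|\ge\gamma|W_k|$. Here $|\cdot|$ is length. The set $E$ is $(\alpha,\gamma)$-winning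 if White has a strategy guaranteeing $\bigcap_k W_k\subset E$, and $\alpha$-winning if it is $(\alpha,\gamma)$-winning for all $\gamma\in(0,1)$. *)

theory Defs
  imports "HOL-Analysis.Analysis"
begin

definition beta_map :: "real \<Rightarrow> real \<Rightarrow> real" where
  "beta_map \<beta> x = frac (\<beta> * x)"

definition beta_digits :: "real \<Rightarrow> real \<Rightarrow> nat \<Rightarrow> nat" where
  "beta_digits \<beta> x n = nat \<lfloor>\<beta> * (beta_map \<beta> ^^ n) x\<rfloor>"

text \<open>
  The topology on \<^typ>\<open>nat \<Rightarrow> nat\<close> is the type-class one,
  i.e. the product of the discrete topologies.
\<close>

definition beta_shift :: "real \<Rightarrow> (nat \<Rightarrow> nat) set" where
  "beta_shift \<beta> = closure (beta_digits \<beta> ` {0..<1})"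

definition beta_value :: "real \<Rightarrow> (nat \<Rightarrow> nat) \<Rightarrow> real" where
  "beta_value \<beta> s = (\<Sum>k. real (s k) / \<beta> ^ (k + 1))"

definition occurs_in :: "'a list \<Rightarrow> (nat \<Rightarrow> 'a) set \<Rightarrow> bool" where
  "occurs_in w X \<longleftrightarrow> (\<exists>s\<in>X. \<exists>m. map s [m..<m + length w] = w)"

definition subshift_of_finite_type :: "(nat \<Rightarrow> 'a) set \<Rightarrow> bool" where
  "subshift_of_finite_type X \<longleftrightarrow>
     (\<exists>A F. finite A \<and> finite F \<and>
        X = {s. range s \<subseteq> A \<and> (\<forall>w\<in>F. \<not> occurs_in w {s})})"

definition orbit_avoiding :: "(real \<Rightarrow> real) \<Rightarrow> real set \<Rightarrow> real set" where
  "orbit_avoiding f Z = {y \<in> {0..<1}. Z \<inter> closure (\<Union>n. {(f ^^ n) y}) = {}}"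

definition closed_interval :: "real set \<Rightarrow> bool" where
  "closed_interval I \<longleftrightarrow> (\<exists>a b. a < b \<and> I = {a..b})"

abbreviation len :: "real set \<Rightarrow> real" where
  "len I \<equiv> measure lborel I"

text \<open>
  A strategy for White maps the list of Black's moves made so far to White's next move;
  White's own earlier moves are determined by these.
\<close>

type_synonym strategy = "real set list \<Rightarrow> real set"

definition white_move :: "strategy \<Rightarrow> (nat \<Rightarrow> real set) \<Rightarrow> nat \<Rightarrow> real set" where
  "white_move \<sigma> B k = \<sigma> (map B [0..<Suc k])"

definition white_legal :: "real \<Rightarrow> strategy \<Rightarrow> (nat \<Rightarrow> real set) \<Rightarrow> nat \<Rightarrow> bool" where
  "white_legal \<alpha> \<sigma> B k \<longleftrightarrow>
     closed_interval (white_move \<sigma> B k) \<and> white_move \<sigma> B k \<subseteq> B k \<and>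
     len (white_move \<sigma> B k) \<ge> \<alpha> * len (B k)"

fun black_legal :: "real \<Rightarrow> strategy \<Rightarrow> (nat \<Rightarrow> real set) \<Rightarrow> nat \<Rightarrow> bool" where
  "black_legal \<gamma> \<sigma> B 0 \<longleftrightarrow> closed_interval (B 0) \<and> B 0 \<subseteq> {0..1}"
| "black_legal \<gamma> \<sigma> B (Suc k) \<longleftrightarrow>
     closed_interval (B (Suc k)) \<and> B (Suc k) \<subseteq> white_move \<sigma> B k \<and>
     len (B (Suc k)) \<ge> \<gamma> * len (white_move \<sigma> B k)"

text \<open>
  Legality of White's moves is demanded after every finite legal play of Black. Asking for it
  only along infinite legal plays would let White escape by an illegal move that leaves Black
  without a legal reply.
\<close>

definition winning2 :: "real \<Rightarrow> real \<Rightarrow> real set \<Rightarrow> bool" where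
  "winning2 \<alpha> \<gamma> E \<longleftrightarrow>
     (\<exists>\<sigma>. \<forall>B.
        (\<forall>k. (\<forall>j\<le>k. black_legal \<gamma> \<sigma> B j) \<longrightarrow> white_legal \<alpha> \<sigma> B k) \<and>
        ((\<forall>k. black_legal \<gamma> \<sigma> B k) \<longrightarrow> (\<Inter>k. white_move \<sigma> B k) \<subseteq> E))"

definition winning :: "real \<Rightarrow> real set \<Rightarrow> bool" where
  "winning \<alpha> E \<longleftrightarrow> (\<forall>\<gamma>. 0 < \<gamma> \<and> \<gamma> < 1 \<longrightarrow> winning2 \<alpha> \<gamma> E)"

end

theory Submission
  imports Defs
begin

text \<open>
  Write f for the \<beta>-transformation and Z for the image of the subshift. The subshift is invariant
  under dropping digits, and on an open interval on which the first n digits are constant f^n is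
  affine; moreover any sequence of the \<beta>-shift whose value lies in such an interval starts with
  these digits. Hence if f^n maps an interval with constant first n digits off Z, so do all earlier
  iterates (\<open>image_avoids_earlier\<close>). White therefore does not have to control every iterate of
  f: it suffices to find, in each of Black's intervals B, a subinterval (u,v) of comparable length
  and a single time n such that the first n digits are constant on (u,v) and f^n maps (u,v) off Z.
  White plays the middle third of (u,v). That keeps the orbit away from Z up to time n, at a
  distance that is bounded below in the whole play if the lengths \<beta>^n (v - u) of the images are.

  Such a subinterval exists with a length ratio that depends only on \<beta> and Z. Iterate f on B
  until a discontinuity a falls into it. To the right of a the next iterate starts at 0 and keeps
  expanding until it covers (0,1), and (0,1) contains a gap of Z because a word of the
  \<beta>-shift is missing from the subshift. So if a leaves a substantial part of B on its right, that part
  contains a suitable interval. Otherwise one has to work to the left of a, where the iterate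
  comes close to 1 from below, and there are two cases.

  If Z stays away from a left neighbourhood of 1, the iterate itself is already off Z to the left
  of a (\<open>uniform_escape_away_from_one\<close>). Its image may be very short, but an interval that
  is mapped that close to 1 follows the orbit of 1 for a long time without being cut, and expands
  far enough to make up for any loss that Black can cause in one turn. This bounds the lengths of
  the images from below in each single play (\<open>escape_sequence_scale_bounded_below\<close>).

  If Z accumulates at 1 from below, the quasi-greedy expansion of 1 lies in the subshift. Then the
  quasi-greedy orbit of 1 is bounded away from 0: a value close to 0 comes from a long block of
  zeros, and deleting one zero from a block that is longer than all forbidden words would give a
  sequence of the subshift with a value above 1 (\<open>quasi_orbit_bounded_below\<close>). The part to
  the left of a follows the orbit of 1, so when it is cut next, the right part of that second cut
  has a substantial length (\<open>uniform_escape_quasi_orbit_bounded_below\<close>).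
\<close>

section \<open>Intervals with constant digits and subshifts\<close>

definition same_digits :: "real \<Rightarrow> nat \<Rightarrow> real set \<Rightarrow> bool" where
  "same_digits \<beta> n I \<longleftrightarrow> (\<forall>i<n. \<forall>x\<in>I. \<forall>y\<in>I. beta_digits \<beta> x i = beta_digits \<beta> y i)"

lemma same_digitsD:
  "same_digits \<beta> n I \<Longrightarrow> i < n \<Longrightarrow> x \<in> I \<Longrightarrow> y \<in> I \<Longrightarrow> beta_digits \<beta> x i = beta_digits \<beta> y i"
  unfolding same_digits_def by blast

lemma same_digits_mono:
  "same_digits \<beta> n I \<Longrightarrow> m \<le> n \<Longrightarrow> J \<subseteq> I \<Longrightarrow> same_digits \<beta> m J"
  unfolding same_digits_def by (blast intro: less_le_trans)

lemma same_digits_SucI: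
  assumes "same_digits \<beta> n I" "\<And>y. y \<in> I \<Longrightarrow> beta_digits \<beta> y n = d"
  shows "same_digits \<beta> (Suc n) I"
  unfolding same_digits_def
proof (intro allI impI ballI)
  fix i x y assume "i < Suc n" "x \<in> I" "y \<in> I"
  moreover from this have "i < n \<Longrightarrow> beta_digits \<beta> x i = beta_digits \<beta> y i"
    using same_digitsD[OF assms(1)] by blast
  ultimately show "beta_digits \<beta> x i = beta_digits \<beta> y i"
    using assms(2)[of x] assms(2)[of y] by (cases "i = n") simp_all
qed


text \<open>
  The conclusion of a successful search by White in Black's interval [p,q]. Here n is a time up to
  which the digits are constant on (u,v) and at which (u,v) is mapped off Z. The requirement that n
  exceeds every time up to which the digits are constant on (p,q) makes these times increase during
  a play. The second alternative of the final disjunction is the price for a cut that leaves nearly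
  all of (p,q) on its left at a time when the image of (p,q) is still short: the image of (u,v) is
  then short too, but it ends at 1.
\<close>

definition escape :: "real \<Rightarrow> real \<Rightarrow> real set \<Rightarrow> real \<Rightarrow> real \<Rightarrow> nat \<Rightarrow> real \<Rightarrow> real \<Rightarrow> bool" where
  "escape \<beta> c Z p q n u v \<longleftrightarrow>
     p \<le> u \<and> u < v \<and> v \<le> q \<and> c * (q - p) \<le> v - u \<and>
     same_digits \<beta> n {u<..<v} \<and> (\<forall>m. same_digits \<beta> m {p<..<q} \<longrightarrow> m < n) \<and>
     (beta_map \<beta> ^^ n) ` {u<..<v} \<inter> Z = {} \<and>
     (c \<le> \<beta> ^ n * (v - u) \<or> (\<forall>y\<in>{u<..<v}. 1 - \<beta> ^ n * (v - u) \<le> (beta_map \<beta> ^^ n) y))"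

lemma occurs_in_singleton_iff:
  "occurs_in w {s} \<longleftrightarrow> (\<exists>m. \<forall>i<length w. s (m + i) = w ! i)"
proof -
  have nth: "map s [m..<m + length w] ! i = s (m + i)" if "i < length w" for m i
    using that by simp
  have "map s [m..<m + length w] = w \<longleftrightarrow> (\<forall>i<length w. s (m + i) = w ! i)" for m
  proof
    assume "map s [m..<m + length w] = w"
    then show "\<forall>i<length w. s (m + i) = w ! i" using nth by metis
  next
    assume "\<forall>i<length w. s (m + i) = w ! i"
    then show "map s [m..<m + length w] = w" by (intro nth_equalityI) (auto simp: nth)
  qed
  then show ?thesis unfolding occurs_in_def by blast
qed

lemma subshift_shift_closed:
  assumes "subshift_of_finite_type X" "s \<in> X"
  shows "(\<lambda>i. s (l + i)) \<in> X"
proof -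
  obtain A F where X: "X = {s. range s \<subseteq> A \<and> (\<forall>w\<in>F. \<not> occurs_in w {s})}"
    using assms(1) unfolding subshift_of_finite_type_def by blast
  have "occurs_in w {s}" if "occurs_in w {\<lambda>i. s (l + i)}" for w
    using that unfolding occurs_in_singleton_iff by (metis add.assoc)
  then show ?thesis using assms(2) unfolding X by auto
qed

context
  fixes \<beta> :: real
  assumes beta_gt_1: "\<beta> > 1"
begin

section \<open>Digits and iterates\<close>

lemma beta_pos [simp]: "\<beta> > 0" "\<beta> \<noteq> 0" "0 \<le> \<beta>" "1 < \<beta>" "1 \<le> \<beta>"
  using beta_gt_1 by auto

lemma funpow_beta_map_range:
  assumes "0 \<le> y" "y < 1"
  shows "0 \<le> (beta_map \<beta> ^^ n) y" "(beta_map \<beta> ^^ n) y < 1"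
proof -
  have "0 \<le> (beta_map \<beta> ^^ n) y \<and> (beta_map \<beta> ^^ n) y < 1"
    using assms by (cases n) (auto simp: beta_map_def frac_lt_1)
  then show "0 \<le> (beta_map \<beta> ^^ n) y" "(beta_map \<beta> ^^ n) y < 1" by auto
qed

lemma funpow_beta_map_nonneg: "0 \<le> y \<Longrightarrow> 0 \<le> (beta_map \<beta> ^^ n) y"
  by (cases n) (simp_all add: beta_map_def)

lemma funpow_beta_map_Suc:
  assumes "0 \<le> y"
  shows "(beta_map \<beta> ^^ Suc n) y = \<beta> * (beta_map \<beta> ^^ n) y - real (beta_digits \<beta> y n)"
proof -
  have "0 \<le> \<beta> * (beta_map \<beta> ^^ n) y" using funpow_beta_map_nonneg[OF assms, of n] by simp
  then have "real (beta_digits \<beta> y n) = of_int \<lfloor>\<beta> * (beta_map \<beta> ^^ n) y\<rfloor>"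
    unfolding beta_digits_def by simp
  then show ?thesis unfolding funpow.simps comp_apply beta_map_def[of \<beta> "(beta_map \<beta> ^^ n) y"] frac_def
    by linarith
qed

lemma beta_digits_eqI:
  assumes "real d \<le> \<beta> * (beta_map \<beta> ^^ n) y" "\<beta> * (beta_map \<beta> ^^ n) y < real d + 1"
  shows "beta_digits \<beta> y n = d"
  using assms unfolding beta_digits_def by linarith

lemma beta_digits_bounds:
  assumes "0 \<le> y"
  shows "real (beta_digits \<beta> y n) \<le> \<beta> * (beta_map \<beta> ^^ n) y"
    "\<beta> * (beta_map \<beta> ^^ n) y < real (beta_digits \<beta> y n) + 1"
proof -
  have "0 \<le> \<beta> * (beta_map \<beta> ^^ n) y" using funpow_beta_map_nonneg[OF assms, of n] by simp
  then show "real (beta_digits \<beta> y n) \<le> \<beta> * (beta_map \<beta> ^^ n) y"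
    "\<beta> * (beta_map \<beta> ^^ n) y < real (beta_digits \<beta> y n) + 1"
    unfolding beta_digits_def by linarith+
qed

lemma beta_digits_funpow: "beta_digits \<beta> ((beta_map \<beta> ^^ m) y) i = beta_digits \<beta> y (m + i)"
  by (simp add: beta_digits_def add.commute[of m] funpow_add)

lemma beta_expansion:
  assumes "0 \<le> y"
  shows "y = (\<Sum>i<n. real (beta_digits \<beta> y i) / \<beta> ^ (i + 1)) + (beta_map \<beta> ^^ n) y / \<beta> ^ n"
proof (induction n)
  case (Suc n)
  have "(beta_map \<beta> ^^ n) y / \<beta> ^ n = real (beta_digits \<beta> y n) / \<beta> ^ (n + 1) + (beta_map \<beta> ^^ Suc n) y / \<beta> ^ Suc n"
    unfolding funpow_beta_map_Suc[OF assms] by (simp add: field_simps)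
  then show ?case using Suc by simp
qed simp

lemma same_digits_affine:
  assumes "same_digits \<beta> n I" "x \<in> I" "y \<in> I" "0 \<le> x" "0 \<le> y"
  shows "(beta_map \<beta> ^^ n) x - (beta_map \<beta> ^^ n) y = \<beta> ^ n * (x - y)"
  using assms(1)
proof (induction n)
  case (Suc n)
  have "same_digits \<beta> n I" using Suc.prems same_digits_mono le_SucI by blast
  moreover have "beta_digits \<beta> x n = beta_digits \<beta> y n"
    by (rule same_digitsD[OF Suc.prems _ assms(2,3)]) simp
  ultimately show ?case
    unfolding funpow_beta_map_Suc[OF assms(4)] funpow_beta_map_Suc[OF assms(5)]
    using arg_cong[OF Suc.IH, of "(*) \<beta>"] by (simp add: algebra_simps)
qed simp

lemma same_digits_image:
  assumes "same_digits \<beta> n I" "m + l \<le> n"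
  shows "same_digits \<beta> l ((beta_map \<beta> ^^ m) ` I)"
  unfolding same_digits_def
proof (intro allI impI ballI)
  fix i x y assume "i < l" "x \<in> (beta_map \<beta> ^^ m) ` I" "y \<in> (beta_map \<beta> ^^ m) ` I"
  then obtain x' y' where *: "x' \<in> I" "y' \<in> I" "x = (beta_map \<beta> ^^ m) x'" "y = (beta_map \<beta> ^^ m) y'"
    by blast
  have "m + i < n" using \<open>i < l\<close> assms(2) by simp
  show "beta_digits \<beta> x i = beta_digits \<beta> y i"
    unfolding *(3,4) beta_digits_funpow by (rule same_digitsD[OF assms(1) \<open>m + i < n\<close> *(1,2)])
qed

lemma image_open_interval:
  assumes "same_digits \<beta> n {u<..<v}" "0 \<le> u" "y \<in> {u<..<v}"
  shows "(beta_map \<beta> ^^ n) ` {u<..<v} =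
    {(beta_map \<beta> ^^ n) y - \<beta> ^ n * (y - u) <..< (beta_map \<beta> ^^ n) y + \<beta> ^ n * (v - y)}"
    (is "?f ` _ = {?a<..<?b}")
proof
  have eq: "?f x = ?f y + \<beta> ^ n * (x - y)" if "x \<in> {u<..<v}" for x
    using same_digits_affine[OF assms(1) that assms(3)] that assms by auto
  show "?f ` {u<..<v} \<subseteq> {?a<..<?b}"
    using eq by (auto simp: algebra_simps)
  show "{?a<..<?b} \<subseteq> ?f ` {u<..<v}"
  proof
    fix z assume z: "z \<in> {?a<..<?b}"
    define x where "x = y + (z - ?f y) / \<beta> ^ n"
    have "x \<in> {u<..<v}" using z by (auto simp: x_def field_simps)
    moreover from this have "?f x = z" using eq by (simp add: x_def)
    ultimately show "z \<in> ?f ` {u<..<v}" by blast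
  qed
qed

section \<open>Values of sequences in the shift\<close>

lemma value_summable:
  assumes "\<And>i. real (s i) \<le> \<beta>"
  shows "summable (\<lambda>k. real (s k) / \<beta> ^ (k + 1))"
    "0 \<le> beta_value \<beta> s" "beta_value \<beta> s \<le> \<beta> / (\<beta> - 1)"
proof -
  have g: "(\<lambda>k. (1 / \<beta>) ^ k) sums (1 / (1 - 1 / \<beta>))"
    by (rule geometric_sums) (use beta_gt_1 in simp)
  have le: "real (s k) / \<beta> ^ (k + 1) \<le> (1 / \<beta>) ^ k" for k
    using assms[of k] by (simp add: field_simps)
  have g': "1 / (1 - 1 / \<beta>) = \<beta> / (\<beta> - 1)" using beta_gt_1 by (simp add: field_simps)
  show sm: "summable (\<lambda>k. real (s k) / \<beta> ^ (k + 1))"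
    by (rule summable_comparison_test[OF _ sums_summable[OF g]]) (use le in \<open>auto\<close>)
  show "0 \<le> beta_value \<beta> s" unfolding beta_value_def by (rule suminf_nonneg[OF sm]) simp
  show "beta_value \<beta> s \<le> \<beta> / (\<beta> - 1)"
    unfolding beta_value_def g'[symmetric] sums_unique[OF g]
    by (rule suminf_le[OF le sm sums_summable[OF g]])
qed

lemma value_split:
  assumes "\<And>i. real (s i) \<le> \<beta>"
  shows "beta_value \<beta> s = (\<Sum>i<n. real (s i) / \<beta> ^ (i + 1)) + beta_value \<beta> (\<lambda>i. s (n + i)) / \<beta> ^ n"
proof -
  have sm: "summable (\<lambda>k. real (s (n + k)) / \<beta> ^ (k + 1))"
    by (rule value_summable) (rule assms)
  have "beta_value \<beta> s = (\<Sum>k. real (s (k + n)) / \<beta> ^ (k + n + 1)) + (\<Sum>i<n. real (s i) / \<beta> ^ (i + 1))"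
    unfolding beta_value_def by (rule suminf_split_initial_segment[OF value_summable(1)[OF assms]])
  also have "(\<lambda>k. real (s (k + n)) / \<beta> ^ (k + n + 1)) = (\<lambda>k. (real (s (n + k)) / \<beta> ^ (k + 1)) / \<beta> ^ n)"
    by (auto simp: power_add add.commute field_simps)
  also have "(\<Sum>k. (real (s (n + k)) / \<beta> ^ (k + 1)) / \<beta> ^ n) = beta_value \<beta> (\<lambda>i. s (n + i)) / \<beta> ^ n"
    unfolding beta_value_def by (rule suminf_divide[OF sm])
  finally show ?thesis by simp
qed

lemma digits_le_beta:
  assumes "0 \<le> y" "y < 1" shows "real (beta_digits \<beta> y i) \<le> \<beta>"
  using beta_digits_bounds(1)[OF assms(1), of i] funpow_beta_map_range(2)[OF assms, of i]
    mult_left_mono[of "(beta_map \<beta> ^^ i) y" 1 \<beta>] beta_pos(3) by linarith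

lemma beta_shift_prefix:
  assumes "s \<in> beta_shift \<beta>"
  obtains x where "0 \<le> x" "x < 1" "\<And>i. i < K \<Longrightarrow> s i = beta_digits \<beta> x i"
proof -
  let ?U = "\<Inter>i\<in>{..<K}. (\<lambda>t::nat\<Rightarrow>nat. t i) -` {s i}"
  have "open ?U"
    by (intro open_INT finite_lessThan ballI open_vimage open_discrete continuous_on_product_coordinates)
  moreover have "s \<in> ?U" by auto
  ultimately have "?U \<inter> beta_digits \<beta> ` {0..<1} \<noteq> {}"
    using assms open_Int_closure_eq_empty unfolding beta_shift_def by blast
  then obtain x where "0 \<le> x" "x < 1" "beta_digits \<beta> x \<in> ?U" by auto
  then show ?thesis using that[of x] by auto
qed

lemma beta_shift_digit_le:
  assumes "s \<in> beta_shift \<beta>" shows "real (s i) \<le> \<beta>"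
proof -
  obtain x where "0 \<le> x" "x < 1" "\<And>j. j < Suc i \<Longrightarrow> s j = beta_digits \<beta> x j"
    using beta_shift_prefix[OF assms, of "Suc i"] by blast
  then show ?thesis using digits_le_beta[of x i] by simp
qed

text \<open>
  Values of sequences in the closure are controlled by genuine expansions with a common prefix,
  because the value depends continuously on bounded sequences. The bound on x is strict although
  the value itself may be 1.
\<close>

lemma beta_shift_approx:
  assumes "s \<in> beta_shift \<beta>" "\<epsilon> > 0"
  obtains x where "0 \<le> x" "x < 1" "\<bar>beta_value \<beta> s - x\<bar> < \<epsilon>" "\<And>i. i < K \<Longrightarrow> s i = beta_digits \<beta> x i"
proof -
  define C where "C = \<beta> / (\<beta> - 1) + 1"
  have C: "C > 0" using beta_gt_1 by (simp add: C_def add_pos_pos)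
  obtain N where N: "C / \<epsilon> < \<beta> ^ N" using real_arch_pow[OF beta_gt_1] by blast
  define L where "L = max N K"
  have L: "C / \<epsilon> < \<beta> ^ L"
    using N by (rule order_less_le_trans) (auto simp: L_def intro: power_increasing)
  obtain x where x: "0 \<le> x" "x < 1" "\<And>i. i < L \<Longrightarrow> s i = beta_digits \<beta> x i"
    using beta_shift_prefix[OF assms(1), of L] by blast
  let ?r = "beta_value \<beta> (\<lambda>i. s (L + i))"
  note le = beta_shift_digit_le[OF assms(1)]
  have r: "0 \<le> ?r" "?r \<le> \<beta> / (\<beta> - 1)" by (intro value_summable le)+
  have f: "0 \<le> (beta_map \<beta> ^^ L) x" "(beta_map \<beta> ^^ L) x < 1"
    using funpow_beta_map_range x by auto
  have "(\<Sum>i<L. real (s i) / \<beta> ^ (i + 1)) = (\<Sum>i<L. real (beta_digits \<beta> x i) / \<beta> ^ (i + 1))"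
    using x(3) by (intro sum.cong) auto
  then have "beta_value \<beta> s - x = (?r - (beta_map \<beta> ^^ L) x) / \<beta> ^ L"
    using value_split[of s L, OF le] beta_expansion[OF x(1), of L] by (simp add: diff_divide_distrib)
  then have "\<bar>beta_value \<beta> s - x\<bar> = \<bar>?r - (beta_map \<beta> ^^ L) x\<bar> / \<beta> ^ L" by simp
  also have "\<dots> \<le> C / \<beta> ^ L"
    by (intro divide_right_mono) (use r f in \<open>auto simp: C_def\<close>)
  also have "\<dots> < \<epsilon>" using L assms(2) by (simp add: field_simps)
  finally show ?thesis using that[of x] x by (auto simp: L_def)
qed

text \<open>
  A second expansion of a point comes from a discontinuity of an iterate: a sequence of the shift is
  approximated by expansions of points near its value, and these points stay in V.
\<close>

lemma beta_shift_itinerary: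
  assumes "s \<in> beta_shift \<beta>" "open V" "same_digits \<beta> l V" "beta_value \<beta> s \<in> V" "i < l"
  shows "s i = beta_digits \<beta> (beta_value \<beta> s) i"
proof -
  obtain \<epsilon> where "\<epsilon> > 0" and e: "\<And>x. \<bar>x - beta_value \<beta> s\<bar> < \<epsilon> \<Longrightarrow> x \<in> V"
    using assms(2,4) unfolding open_dist dist_real_def by blast
  obtain x where "\<bar>beta_value \<beta> s - x\<bar> < \<epsilon>" "\<And>i. i < l \<Longrightarrow> s i = beta_digits \<beta> x i"
    using beta_shift_approx[OF assms(1) \<open>\<epsilon> > 0\<close>, of l] by blast
  then show ?thesis
    using e[of x] same_digitsD[OF assms(3,5) _ assms(4), of x] assms(5) by (simp add: abs_minus_commute)
qed

lemma beta_shift_value_shift: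
  assumes "s \<in> beta_shift \<beta>" "open V" "same_digits \<beta> l V" "beta_value \<beta> s \<in> V"
  shows "beta_value \<beta> (\<lambda>i. s (l + i)) = (beta_map \<beta> ^^ l) (beta_value \<beta> s)"
proof -
  let ?z = "beta_value \<beta> s"
  note le = beta_shift_digit_le[OF assms(1)]
  have "0 \<le> ?z" using value_summable(2)[OF le] .
  moreover have "(\<Sum>i<l. real (s i) / \<beta> ^ (i + 1)) = (\<Sum>i<l. real (beta_digits \<beta> ?z i) / \<beta> ^ (i + 1))"
    using beta_shift_itinerary[OF assms] by (intro sum.cong) auto
  ultimately have "beta_value \<beta> (\<lambda>i. s (l + i)) / \<beta> ^ l = (beta_map \<beta> ^^ l) ?z / \<beta> ^ l"
    using beta_expansion[of ?z l] value_split[of s l, OF le] by linarith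
  then show ?thesis by simp
qed

section \<open>The left limit orbit of 1\<close>

text \<open>
  The left-continuous version of the \<beta>-transformation, with values in (0,1]. Its orbit of 1 and
  the corresponding digits are the quasi-greedy expansion of 1, the limit of the expansions of x
  as x tends to 1 from below.
\<close>

definition quasi_step :: "real \<Rightarrow> real" where
  "quasi_step x = \<beta> * x - real_of_int \<lceil>\<beta> * x\<rceil> + 1"

definition quasi_orbit :: "nat \<Rightarrow> real" where
  "quasi_orbit n = (quasi_step ^^ n) 1"

definition quasi_digit :: "nat \<Rightarrow> nat" where
  "quasi_digit n = nat (\<lceil>\<beta> * quasi_orbit n\<rceil> - 1)"

lemma quasi_orbit_0: "quasi_orbit 0 = 1" by (simp add: quasi_orbit_def)
lemma quasi_orbit_Suc: "quasi_orbit (Suc n) = quasi_step (quasi_orbit n)"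
  by (simp add: quasi_orbit_def)

lemma quasi_step_range: "0 < quasi_step x" "quasi_step x \<le> 1"
  unfolding quasi_step_def by linarith+

lemma quasi_orbit_range: "0 < quasi_orbit n" "quasi_orbit n \<le> 1"
  by (cases n; simp add: quasi_orbit_0 quasi_orbit_Suc quasi_step_range)+

lemma quasi_digit: "real (quasi_digit n) = \<beta> * quasi_orbit n - quasi_orbit (Suc n)"
proof -
  have "\<beta> * quasi_orbit n > 0" using quasi_orbit_range by simp
  then have "\<lceil>\<beta> * quasi_orbit n\<rceil> \<ge> 1" by linarith
  then show ?thesis by (simp add: quasi_digit_def quasi_orbit_Suc quasi_step_def)
qed

lemma left_of_one:
  "\<exists>\<eta>>0. \<eta> \<le> 1 \<and> (\<forall>y. 1 - \<eta> < y \<and> y < 1 \<longrightarrow>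
     (\<forall>i<n. beta_digits \<beta> y i = quasi_digit i) \<and>
     (beta_map \<beta> ^^ n) y = quasi_orbit n - \<beta> ^ n * (1 - y))"
proof (induction n)
  case 0
  show ?case by (rule exI[of _ 1]) (simp add: quasi_orbit_0)
next
  case (Suc n)
  then obtain \<eta> where eta: "\<eta> > 0" "\<eta> \<le> 1" and *: "\<And>y. 1 - \<eta> < y \<Longrightarrow> y < 1 \<Longrightarrow>
     (\<forall>i<n. beta_digits \<beta> y i = quasi_digit i) \<and>
     (beta_map \<beta> ^^ n) y = quasi_orbit n - \<beta> ^ n * (1 - y)" by blast
  define \<eta>' where "\<eta>' = min \<eta> (quasi_orbit (Suc n) / \<beta> ^ Suc n)"
  have "\<eta>' > 0" "\<eta>' \<le> 1" using eta quasi_orbit_range(1)[of "Suc n"] by (auto simp: \<eta>'_def)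
  moreover have "(\<forall>i<Suc n. beta_digits \<beta> y i = quasi_digit i) \<and>
     (beta_map \<beta> ^^ Suc n) y = quasi_orbit (Suc n) - \<beta> ^ Suc n * (1 - y)"
    if y: "1 - \<eta>' < y" "y < 1" for y
  proof -
    have y': "1 - \<eta> < y" "0 \<le> y" using y \<open>\<eta>' \<le> 1\<close> by (auto simp: \<eta>'_def)
    have f: "\<beta> * (beta_map \<beta> ^^ n) y = real (quasi_digit n) + quasi_orbit (Suc n) - \<beta> ^ Suc n * (1 - y)"
      using *[OF y'(1) y(2)] by (simp only: quasi_digit power_Suc) (simp add: right_diff_distrib)
    have "(1 - y) < quasi_orbit (Suc n) / \<beta> ^ Suc n" using y by (auto simp: \<eta>'_def)
    then have "\<beta> ^ Suc n * (1 - y) < quasi_orbit (Suc n)" by (simp add: field_simps)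
    moreover have "\<beta> ^ Suc n * (1 - y) > 0" using y by simp
    ultimately have d: "beta_digits \<beta> y n = quasi_digit n"
      using f quasi_orbit_range(2)[of "Suc n"] by (intro beta_digits_eqI) linarith+
    then have "(beta_map \<beta> ^^ Suc n) y = quasi_orbit (Suc n) - \<beta> ^ Suc n * (1 - y)"
      unfolding funpow_beta_map_Suc[OF y'(2)] using f by linarith
    with d show ?thesis using *[OF y'(1) y(2)] by (metis less_Suc_eq)
  qed
  ultimately show ?case by blast
qed


section \<open>Cutting an interval\<close>

lemma same_digits_length:
  assumes "same_digits \<beta> k {p<..<q}" "0 \<le> p" "p < q" "q \<le> 1"
  shows "\<beta> ^ k * (q - p) \<le> 1"
proof (rule ccontr)
  assume "\<not> ?thesis"
  then have big: "1 / \<beta> ^ k < q - p" by (simp add: field_simps)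
  define \<epsilon> where "\<epsilon> = (q - p - 1 / \<beta> ^ k) / 4"
  have eps: "4 * \<epsilon> = q - p - 1 / \<beta> ^ k" by (simp add: \<epsilon>_def)
  have "0 < 1 / \<beta> ^ k" by simp
  then have "0 < \<epsilon>" "4 * \<epsilon> < q - p" using eps big by linarith+
  define x where "x = p + \<epsilon>"
  define y where "y = q - \<epsilon>"
  have xy: "x \<in> {p<..<q}" "y \<in> {p<..<q}"
    using \<open>0 < \<epsilon>\<close> \<open>4 * \<epsilon> < q - p\<close> by (auto simp: x_def y_def)
  have "1 / \<beta> ^ k < y - x" unfolding x_def y_def using \<open>0 < \<epsilon>\<close> eps by linarith
  then have "1 < \<beta> ^ k * (y - x)" by (simp add: field_simps)
  also have "\<dots> = (beta_map \<beta> ^^ k) y - (beta_map \<beta> ^^ k) x"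
    using same_digits_affine[OF assms(1) xy(2,1)] xy assms by simp
  also have "\<dots> < 1"
    using funpow_beta_map_range[of x k] funpow_beta_map_range[of y k] xy assms by simp
  finally show False .
qed

text \<open>
  Since f^m stretches lengths by \<beta>^m, there is a last time m at which the digits are constant on
  (p,q). At the next step a is the rightmost point that is mapped to a discontinuity: the iterate
  f^(m+1) starts at 0 to the right of a and ends at 1 to the left of a. The number Q is the left
  limit of f^m at q, so the length of the image of (a,q) is determined by Q alone.
\<close>

lemma first_cut:
  assumes pq: "0 \<le> p" "p < q" "q \<le> 1"
  obtains m a Q where
    "same_digits \<beta> m {p<..<q}" "\<And>k. same_digits \<beta> k {p<..<q} \<Longrightarrow> k \<le> m"
    "p < a" "a < q"
    "\<And>y. y \<in> {p<..<q} \<Longrightarrow> (beta_map \<beta> ^^ m) y = Q - \<beta> ^ m * (q - y)"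
    "\<beta> ^ Suc m * (q - a) = quasi_step Q"
    "same_digits \<beta> (Suc m) {a<..<q}"
    "\<And>y. y \<in> {a<..<q} \<Longrightarrow> (beta_map \<beta> ^^ Suc m) y = \<beta> ^ Suc m * (y - a)"
    "same_digits \<beta> (Suc m) {max p (a - 1 / \<beta> ^ Suc m)<..<a}"
    "\<And>y. y \<in> {max p (a - 1 / \<beta> ^ Suc m)<..<a} \<Longrightarrow>
       (beta_map \<beta> ^^ Suc m) y = 1 - \<beta> ^ Suc m * (a - y)"
proof -
  let ?S = "{k. same_digits \<beta> k {p<..<q}}"
  obtain N where N: "1 / (q - p) < \<beta> ^ N" using real_arch_pow[OF beta_gt_1] by blast
  have "k \<le> N" if "same_digits \<beta> k {p<..<q}" for k
  proof (rule ccontr)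
    assume "\<not> k \<le> N"
    then have "\<beta> ^ N \<le> \<beta> ^ k" by (intro power_increasing) auto
    with N have "1 / (q - p) < \<beta> ^ k" by linarith
    then have "1 < \<beta> ^ k * (q - p)" using pq by (simp add: field_simps)
    with same_digits_length[OF that pq] show False by simp
  qed
  then have fin: "finite ?S" by (meson finite_nat_set_iff_bounded_le mem_Collect_eq)
  have "0 \<in> ?S" by (simp add: same_digits_def)
  define m where "m = Max ?S"
  have m: "same_digits \<beta> m {p<..<q}" using Max_in[OF fin] \<open>0 \<in> ?S\<close> unfolding m_def by blast
  have m_max: "k \<le> m" if "same_digits \<beta> k {p<..<q}" for k
    using Max_ge[OF fin] that unfolding m_def by blast
  define y0 where "y0 = (p + q) / 2"
  have y0: "y0 \<in> {p<..<q}" using pq by (simp add: y0_def)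
  define Q where "Q = (beta_map \<beta> ^^ m) y0 + \<beta> ^ m * (q - y0)"
  have aff: "(beta_map \<beta> ^^ m) y = Q - \<beta> ^ m * (q - y)" if "y \<in> {p<..<q}" for y
    using same_digits_affine[OF m that y0] that y0 pq by (simp add: Q_def algebra_simps)
  have "0 < Q"
    using funpow_beta_map_range(1)[of y0 m] y0 pq by (simp add: Q_def add_nonneg_pos)
  \<comment> \<open>The largest integer below the left limit of \<beta> f^m at q; a is where \<beta> f^m takes this value.\<close>
  define i where "i = \<lceil>\<beta> * Q\<rceil> - 1"
  have "0 < \<beta> * Q" using \<open>0 < Q\<close> by simp
  then have i: "0 \<le> i" "of_int i < \<beta> * Q" "\<beta> * Q \<le> of_int i + 1"
    unfolding i_def by linarith+
  define a where "a = q - (\<beta> * Q - of_int i) / \<beta> ^ Suc m"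
  have a: "\<beta> ^ Suc m * (q - a) = \<beta> * Q - of_int i" by (simp add: a_def)
  have "a < q" using i by (simp add: a_def)
  have step: "\<beta> * (beta_map \<beta> ^^ m) y = of_int i + \<beta> ^ Suc m * (y - a)" if "y \<in> {p<..<q}" for y
  proof -
    have "\<beta> * (beta_map \<beta> ^^ m) y = \<beta> * Q - \<beta> ^ Suc m * (q - y)"
      using aff[OF that] by (simp add: right_diff_distrib)
    also have "\<dots> = of_int i + (\<beta> ^ Suc m * (q - a) - \<beta> ^ Suc m * (q - y))" using a by simp
    finally show ?thesis by (simp add: right_diff_distrib)
  qed
  have right: "beta_digits \<beta> y m = nat i" if "y \<in> {p<..<q}" "a < y" for y
  proof (rule beta_digits_eqI)
    have "0 < \<beta> ^ Suc m * (y - a)" using that by simp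
    moreover have "\<beta> ^ Suc m * (y - a) < \<beta> ^ Suc m * (q - a)"
      using that by (intro mult_strict_left_mono) auto
    moreover have "real (nat i) = of_int i" using i by simp
    ultimately show "real (nat i) \<le> \<beta> * (beta_map \<beta> ^^ m) y"
      "\<beta> * (beta_map \<beta> ^^ m) y < real (nat i) + 1"
      unfolding step[OF that(1)] using a i by linarith+
  qed
  have "p < a"
  proof (rule ccontr)
    assume "\<not> p < a"
    then have "same_digits \<beta> (Suc m) {p<..<q}"
      using right by (intro same_digits_SucI[OF m, of "nat i"]) auto
    then show False using m_max[of "Suc m"] by simp
  qed
  have "1 \<le> i"
  proof -
    define y where "y = (p + a) / 2"
    have y: "y \<in> {p<..<q}" "y < a" using \<open>p < a\<close> \<open>a < q\<close> by (auto simp: y_def)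
    then have "0 \<le> \<beta> * (beta_map \<beta> ^^ m) y"
      using funpow_beta_map_range(1)[of y m] pq by simp
    moreover have "\<beta> ^ Suc m * (y - a) < 0" using y by (intro mult_pos_neg) auto
    ultimately show ?thesis unfolding step[OF y(1)] by linarith
  qed
  have left: "beta_digits \<beta> y m = nat (i - 1)" if "y \<in> {max p (a - 1 / \<beta> ^ Suc m)<..<a}" for y
  proof (rule beta_digits_eqI)
    have y: "y \<in> {p<..<q}" using that \<open>a < q\<close> by auto
    have "0 < \<beta> ^ Suc m * (a - y)" using that by simp
    moreover have "a - y < 1 / \<beta> ^ Suc m" using that by simp
    then have "\<beta> ^ Suc m * (a - y) < 1" by (simp add: field_simps)
    moreover have "\<beta> * (beta_map \<beta> ^^ m) y = of_int i - \<beta> ^ Suc m * (a - y)"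
      using step[OF y] by (simp add: right_diff_distrib)
    ultimately show "real (nat (i - 1)) \<le> \<beta> * (beta_map \<beta> ^^ m) y"
      "\<beta> * (beta_map \<beta> ^^ m) y < real (nat (i - 1)) + 1"
      using \<open>1 \<le> i\<close> by simp_all
  qed
  show ?thesis
  proof (rule that[of m a Q])
    show "\<beta> ^ Suc m * (q - a) = quasi_step Q" using a by (simp add: quasi_step_def i_def)
    show "same_digits \<beta> (Suc m) {a<..<q}"
      using right \<open>p < a\<close> by (intro same_digits_SucI[OF same_digits_mono[OF m order_refl], of _ "nat i"]) auto
    show "same_digits \<beta> (Suc m) {max p (a - 1 / \<beta> ^ Suc m)<..<a}"
      using left \<open>a < q\<close> by (intro same_digits_SucI[OF same_digits_mono[OF m order_refl], of _ "nat (i - 1)"]) auto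
    fix y
    show "(beta_map \<beta> ^^ Suc m) y = \<beta> ^ Suc m * (y - a)" if "y \<in> {a<..<q}"
    proof -
      have y: "y \<in> {p<..<q}" "0 \<le> y" using that \<open>p < a\<close> pq by auto
      show ?thesis
        unfolding funpow_beta_map_Suc[OF y(2)] step[OF y(1)] using right[OF y(1)] that i by simp
    qed
    show "(beta_map \<beta> ^^ Suc m) y = 1 - \<beta> ^ Suc m * (a - y)"
      if "y \<in> {max p (a - 1 / \<beta> ^ Suc m)<..<a}"
    proof -
      have y: "y \<in> {p<..<q}" "0 \<le> y" using that \<open>a < q\<close> pq by auto
      show ?thesis
        unfolding funpow_beta_map_Suc[OF y(2)] step[OF y(1)] left[OF that]
        using \<open>1 \<le> i\<close> by (simp add: right_diff_distrib)
    qed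
  qed (use m m_max aff \<open>p < a\<close> \<open>a < q\<close> in auto)
qed

text \<open>
  An interval whose image starts at 0 loses nothing while it expands: all digits are 0 until its
  image reaches length 1, and the last step overshoots by at most a factor \<beta>.
\<close>

lemma full_branch:
  assumes ab: "0 \<le> a" "a < b" "b \<le> 1" and k: "same_digits \<beta> k {a<..<b}"
    and aff: "\<And>y. y \<in> {a<..<b} \<Longrightarrow> (beta_map \<beta> ^^ k) y = \<beta> ^ k * (y - a)"
  obtains n where "k \<le> n" "1 \<le> \<beta> ^ n * (b - a)" "\<beta> ^ n * (b - a) \<le> \<beta>"
    "same_digits \<beta> n {a<..<a + 1 / \<beta> ^ n}"
    "\<And>y. y \<in> {a<..<a + 1 / \<beta> ^ n} \<Longrightarrow> (beta_map \<beta> ^^ n) y = \<beta> ^ n * (y - a)"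
proof -
  let ?P = "\<lambda>n. k \<le> n \<and> 1 \<le> \<beta> ^ n * (b - a)"
  have le1: "\<beta> ^ k * (b - a) \<le> 1" using same_digits_length[OF k ab] .
  obtain N where N: "1 / (b - a) < \<beta> ^ N" using real_arch_pow[OF beta_gt_1] by blast
  have "\<beta> ^ N \<le> \<beta> ^ max k N" by (intro power_increasing) auto
  with N have "1 / (b - a) < \<beta> ^ max k N" by linarith
  then have "?P (max k N)" using ab by (simp add: field_simps)
  define n where "n = (LEAST n. ?P n)"
  have n: "?P n" unfolding n_def using LeastI[of ?P, OF \<open>?P (max k N)\<close>] .
  have upper: "\<beta> ^ n * (b - a) \<le> \<beta>"
  proof (cases "n = k")
    case True then show ?thesis unfolding True using le1 beta_gt_1 by linarith
  next
    case False
    then obtain n' where n': "n = Suc n'" "k \<le> n'" using n by (cases n) auto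
    have "\<not> ?P n'" using not_less_Least[of n' ?P] n'(1) unfolding n_def by simp
    then have "\<beta> ^ n' * (b - a) < 1" using n' by simp
    then have "\<beta> * (\<beta> ^ n' * (b - a)) \<le> \<beta> * 1" by (intro mult_left_mono) auto
    then show ?thesis by (simp add: n'(1) mult.assoc)
  qed
  let ?J = "{a<..<a + 1 / \<beta> ^ n}"
  have "1 / \<beta> ^ n \<le> b - a" using n by (simp add: field_simps)
  then have J: "?J \<subseteq> {a<..<b}" by auto
  have "same_digits \<beta> (k + j) ?J \<and> (\<forall>y\<in>?J. (beta_map \<beta> ^^ (k + j)) y = \<beta> ^ (k + j) * (y - a))"
    if "k + j \<le> n" for j
    using that
  proof (induction j)
    case 0
    then show ?case using same_digits_mono[OF k order_refl J] aff J by auto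
  next
    case (Suc j)
    then have IH: "same_digits \<beta> (k + j) ?J"
      "\<And>y. y \<in> ?J \<Longrightarrow> (beta_map \<beta> ^^ (k + j)) y = \<beta> ^ (k + j) * (y - a)" by auto
    have d: "beta_digits \<beta> y (k + j) = 0" if "y \<in> ?J" for y
    proof (rule beta_digits_eqI)
      have eq: "\<beta> * (beta_map \<beta> ^^ (k + j)) y = \<beta> ^ Suc (k + j) * (y - a)"
        using IH(2)[OF that] by simp
      show "real 0 \<le> \<beta> * (beta_map \<beta> ^^ (k + j)) y" unfolding eq using that by simp
      have "\<beta> ^ Suc (k + j) \<le> \<beta> ^ n" using Suc.prems by (intro power_increasing) auto
      then have "\<beta> ^ Suc (k + j) * (y - a) \<le> \<beta> ^ n * (y - a)"
        using that by (intro mult_right_mono) auto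
      also have "y - a < 1 / \<beta> ^ n" using that by auto
      then have "\<beta> ^ n * (y - a) < 1" by (simp add: field_simps)
      finally show "\<beta> * (beta_map \<beta> ^^ (k + j)) y < real 0 + 1" unfolding eq by simp
    qed
    have "(beta_map \<beta> ^^ Suc (k + j)) y = \<beta> ^ Suc (k + j) * (y - a)" if "y \<in> ?J" for y
    proof -
      have "0 \<le> y" using that ab by auto
      show ?thesis unfolding funpow_beta_map_Suc[OF \<open>0 \<le> y\<close>] d[OF that] IH(2)[OF that] by simp
    qed
    then show ?case using same_digits_SucI[OF IH(1) d] by simp
  qed
  from this[of "n - k"] n have "same_digits \<beta> n ?J"
    "\<And>y. y \<in> ?J \<Longrightarrow> (beta_map \<beta> ^^ n) y = \<beta> ^ n * (y - a)" by auto
  then show ?thesis using that n upper by blast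
qed

lemma right_constant:
  assumes "0 \<le> x" "x < 1"
  shows "\<exists>b>x. b \<le> 1 \<and> same_digits \<beta> n {x..<b}"
proof (induction n)
  case 0
  show ?case using assms by (intro exI[of _ 1]) (simp add: same_digits_def)
next
  case (Suc n)
  then obtain b where b: "x < b" "b \<le> 1" "same_digits \<beta> n {x..<b}" by blast
  let ?d = "beta_digits \<beta> x n"
  define r where "r = real ?d + 1 - \<beta> * (beta_map \<beta> ^^ n) x"
  have "0 < r" using beta_digits_bounds(2)[OF assms(1), of n] by (simp add: r_def)
  define b' where "b' = min b (x + r / \<beta> ^ Suc n)"
  have b': "x < b'" "b' \<le> b" using b \<open>0 < r\<close> by (auto simp: b'_def)
  have d: "beta_digits \<beta> y n = ?d" if "y \<in> {x..<b'}" for y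
  proof (rule beta_digits_eqI)
    have "(beta_map \<beta> ^^ n) y - (beta_map \<beta> ^^ n) x = \<beta> ^ n * (y - x)"
      using that b' assms by (intro same_digits_affine[OF b(3)]) auto
    then have "(beta_map \<beta> ^^ n) y = (beta_map \<beta> ^^ n) x + \<beta> ^ n * (y - x)" by simp
    then have eq: "\<beta> * (beta_map \<beta> ^^ n) y = \<beta> * (beta_map \<beta> ^^ n) x + \<beta> ^ Suc n * (y - x)"
      by (simp add: distrib_left)
    have "y - x < r / \<beta> ^ Suc n" "x \<le> y" using that by (auto simp: b'_def)
    then have "\<beta> ^ Suc n * (y - x) < r" "0 \<le> \<beta> ^ Suc n * (y - x)" by (auto simp: field_simps)
    then show "real ?d \<le> \<beta> * (beta_map \<beta> ^^ n) y" "\<beta> * (beta_map \<beta> ^^ n) y < real ?d + 1"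
      unfolding eq using beta_digits_bounds(1)[OF assms(1), of n] by (auto simp: r_def)
  qed
  have "{x..<b'} \<subseteq> {x..<b}" using b' by auto
  from same_digits_SucI[OF same_digits_mono[OF b(3) order_refl this] d]
  have "same_digits \<beta> (Suc n) {x..<b'}" .
  then show ?case using b' b(2) by (intro exI[of _ b']) auto
qed


section \<open>Avoiding the subshift\<close>

text \<open>
  If f^m y were the value of some s in X, then s would start with the digits of f^m y up to time
  n - m, and dropping them would exhibit f^n y as the value of a sequence in X.
\<close>

lemma image_avoids_earlier:
  assumes X: "X \<subseteq> beta_shift \<beta>" and shift: "\<And>s l. s \<in> X \<Longrightarrow> (\<lambda>i. s (l + i)) \<in> X"
    and uv: "0 \<le> u" "v \<le> 1" and sd: "same_digits \<beta> n {u<..<v}"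
    and avoid: "(beta_map \<beta> ^^ n) ` {u<..<v} \<inter> beta_value \<beta> ` X = {}" and "m \<le> n"
  shows "(beta_map \<beta> ^^ m) ` {u<..<v} \<inter> beta_value \<beta> ` X = {}"
proof (rule ccontr)
  assume "\<not> ?thesis"
  then obtain y s where y: "y \<in> {u<..<v}" and s: "s \<in> X"
    and ys: "(beta_map \<beta> ^^ m) y = beta_value \<beta> s" by blast
  let ?V = "(beta_map \<beta> ^^ m) ` {u<..<v}"
  have "open ?V"
    unfolding image_open_interval[OF same_digits_mono[OF sd \<open>m \<le> n\<close> order_refl] uv(1) y] by simp
  moreover have "same_digits \<beta> (n - m) ?V"
    using same_digits_image[OF sd, of m "n - m"] \<open>m \<le> n\<close> by simp
  moreover have "beta_value \<beta> s \<in> ?V" using y unfolding ys[symmetric] by blast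
  ultimately have "beta_value \<beta> (\<lambda>i. s (n - m + i)) = (beta_map \<beta> ^^ (n - m)) (beta_value \<beta> s)"
    using beta_shift_value_shift X s by blast
  also have "\<dots> = (beta_map \<beta> ^^ n) y"
    unfolding ys[symmetric] using \<open>m \<le> n\<close> by (simp flip: funpow_add comp_apply[of "beta_map \<beta> ^^ (n - m)"])
  finally show False using avoid y shift[OF s, of "n - m"] by (metis disjoint_iff image_eqI)
qed

text \<open>
  Expansions are right-continuous, so a word that occurs in an expansion starts the expansion of
  all points of an interval. A sequence of X with its value inside would have to start with w too.
\<close>

lemma omitted_word_gives_gap:
  assumes X: "X \<subseteq> beta_shift \<beta>" and w: "occurs_in w (beta_shift \<beta>)" "\<not> occurs_in w X"
  obtains a b where "0 \<le> a" "a < b" "b \<le> 1" "{a<..<b} \<inter> beta_value \<beta> ` X = {}"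
proof -
  obtain s m where s: "s \<in> beta_shift \<beta>" and "map s [m..<m + length w] = w"
    using w(1) unfolding occurs_in_def by blast
  then have sw: "s (m + i) = w ! i" if "i < length w" for i
    using that by (metis add_diff_cancel_left' length_map length_upt nth_map nth_upt nat_add_left_cancel_less)
  obtain x where x: "0 \<le> x" "x < 1" "\<And>i. i < m + length w \<Longrightarrow> s i = beta_digits \<beta> x i"
    using beta_shift_prefix[OF s] by blast
  let ?a = "(beta_map \<beta> ^^ m) x"
  have a: "0 \<le> ?a" "?a < 1" using funpow_beta_map_range[OF x(1,2)] by auto
  obtain b where b: "?a < b" "b \<le> 1" "same_digits \<beta> (length w) {?a..<b}"
    using right_constant[OF a] by blast
  have "beta_value \<beta> s' \<notin> {?a<..<b}" if "s' \<in> X" for s'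
  proof
    assume V: "beta_value \<beta> s' \<in> {?a<..<b}"
    have sd: "same_digits \<beta> (length w) {?a<..<b}"
      by (rule same_digits_mono[OF b(3) order_refl]) auto
    have "s' i = w ! i" if "i < length w" for i
    proof -
      have "s' i = beta_digits \<beta> (beta_value \<beta> s') i"
        using beta_shift_itinerary[OF _ _ sd V that] \<open>s' \<in> X\<close> X by auto
      also have "\<dots> = beta_digits \<beta> ?a i"
        using same_digitsD[OF b(3) that, of "beta_value \<beta> s'" ?a] V b(1) by auto
      also have "\<dots> = w ! i" using sw[OF that] x(3)[of "m + i"] that by (simp add: beta_digits_funpow)
      finally show ?thesis .
    qed
    then have "occurs_in w {s'}" unfolding occurs_in_singleton_iff by (intro exI[of _ 0]) simp
    then show False using w(2) \<open>s' \<in> X\<close> unfolding occurs_in_def by blast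
  qed
  then have "{?a<..<b} \<inter> beta_value \<beta> ` X = {}" by blast
  then show ?thesis using that[OF a(1) b(1,2)] by blast
qed

lemma quasi_orbit_expansion:
  "quasi_orbit n = (\<Sum>i<k. real (quasi_digit (n + i)) / \<beta> ^ (i + 1)) + quasi_orbit (n + k) / \<beta> ^ k"
proof (induction k)
  case (Suc k)
  have "quasi_orbit (n + k) / \<beta> ^ k
      = real (quasi_digit (n + k)) / \<beta> ^ (k + 1) + quasi_orbit (n + Suc k) / \<beta> ^ Suc k"
    by (simp add: quasi_digit field_simps)
  then show ?case using Suc by simp
qed simp

text \<open>
  Sequences of X with values close to 1 share long prefixes with the quasi-greedy expansion of 1,
  and membership in a subshift of finite type is decided on prefixes.
\<close>

lemma quasi_digits_in_subshift:
  assumes X: "X \<subseteq> beta_shift \<beta>" and sft: "subshift_of_finite_type X"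
    and acc: "\<And>\<kappa>. \<kappa> > 0 \<Longrightarrow> {1 - \<kappa><..<1} \<inter> beta_value \<beta> ` X \<noteq> {}"
  shows "quasi_digit \<in> X"
proof -
  have prefix: "\<exists>s\<in>X. \<forall>i<n. s i = quasi_digit i" for n
  proof -
    obtain \<eta> where \<eta>: "\<eta> > 0"
      and *: "\<And>y i. 1 - \<eta> < y \<Longrightarrow> y < 1 \<Longrightarrow> i < n \<Longrightarrow> beta_digits \<beta> y i = quasi_digit i"
      using left_of_one[of n] by metis
    obtain s where s: "s \<in> X" and V: "beta_value \<beta> s \<in> {1 - \<eta><..<1}" using acc[OF \<eta>] by blast
    have "same_digits \<beta> n {1 - \<eta><..<1}" unfolding same_digits_def using * by simp
    then have "s i = quasi_digit i" if "i < n" for i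
      using beta_shift_itinerary[OF _ _ _ V that] s X * V that by auto
    then show ?thesis using s by blast
  qed
  obtain A F where X_def: "X = {s. range s \<subseteq> A \<and> (\<forall>w\<in>F. \<not> occurs_in w {s})}"
    using sft unfolding subshift_of_finite_type_def by blast
  have "quasi_digit i \<in> A" for i
  proof -
    obtain s where "s \<in> X" "s i = quasi_digit i" using prefix[of "Suc i"] by blast
    then show ?thesis unfolding X_def by (metis (mono_tags) mem_Collect_eq rangeI subsetD)
  qed
  moreover have "\<not> occurs_in w {quasi_digit}" if "w \<in> F" for w
  proof
    assume "occurs_in w {quasi_digit}"
    then obtain m where m: "\<forall>i<length w. quasi_digit (m + i) = w ! i"
      unfolding occurs_in_singleton_iff by blast
    obtain s where "s \<in> X" "\<forall>i<m + length w. s i = quasi_digit i" using prefix by blast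
    with m have "occurs_in w {s}" unfolding occurs_in_singleton_iff by (intro exI[of _ m]) auto
    with \<open>s \<in> X\<close> \<open>w \<in> F\<close> show False unfolding X_def by blast
  qed
  ultimately show ?thesis unfolding X_def by blast
qed

text \<open>
  If the orbit came close to 0 at time j, the expansion would have more than M zeros from j on,
  where M bounds the lengths of the forbidden words. Deleting one of these zeros creates no
  forbidden word, but it multiplies the tail by \<beta> and pushes the value above 1.
\<close>

lemma quasi_orbit_bounded_below:
  assumes X: "X \<subseteq> beta_shift \<beta>" and sft: "subshift_of_finite_type X" and e: "quasi_digit \<in> X"
  shows "\<exists>\<tau>>0. \<forall>j. \<tau> \<le> quasi_orbit j"
proof -
  obtain A F where F: "finite F" and X_def: "X = {s. range s \<subseteq> A \<and> (\<forall>w\<in>F. \<not> occurs_in w {s})}"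
    using sft unfolding subshift_of_finite_type_def by blast
  obtain M where M: "\<And>w. w \<in> F \<Longrightarrow> length w \<le> M"
    using F by (metis finite_imageI finite_nat_set_iff_bounded_le imageI)
  have "1 / \<beta> ^ Suc M \<le> quasi_orbit j" for j
  proof (rule ccontr)
    assume "\<not> ?thesis"
    then have small: "\<beta> ^ Suc M * quasi_orbit j < 1" by (simp add: field_simps)
    have scaled: "quasi_orbit (j + i) = \<beta> ^ i * quasi_orbit j \<and> (i \<le> M \<longrightarrow> quasi_digit (j + i) = 0)"
      if "i \<le> Suc M" for i
      using that
    proof (induction i)
      case 0
      then show ?case
      proof -
        have "\<beta> * quasi_orbit j \<le> \<beta> ^ Suc M * quasi_orbit j"
          using power_increasing[of 1 "Suc M" \<beta>] quasi_orbit_range(1)[of j]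
          by (intro mult_right_mono) auto
        then have "\<beta> * quasi_orbit j < 1" using small by linarith
        then have "quasi_digit j = 0" unfolding quasi_digit_def by linarith
        then show ?thesis by simp
      qed
    next
      case (Suc i)
      then have IH: "quasi_orbit (j + i) = \<beta> ^ i * quasi_orbit j" "quasi_digit (j + i) = 0" by auto
      have t: "quasi_orbit (j + Suc i) = \<beta> ^ Suc i * quasi_orbit j"
        using quasi_digit[of "j + i"] IH by simp
      moreover have "quasi_digit (j + Suc i) = 0" if "Suc i \<le> M"
      proof -
        have "\<beta> * quasi_orbit (j + Suc i) = \<beta> ^ Suc (Suc i) * quasi_orbit j" unfolding t by simp
        also have "\<dots> \<le> \<beta> ^ Suc M * quasi_orbit j"
          using that quasi_orbit_range(1)[of j] by (intro mult_right_mono power_increasing) auto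
        also note small
        finally show ?thesis unfolding quasi_digit_def by linarith
      qed
      ultimately show ?case by blast
    qed
    \<comment> \<open>The expansion with its zero at position j deleted.\<close>
    define e' where "e' i = (if i < j then quasi_digit i else quasi_digit (Suc i))" for i
    have e'_shift: "e' i = quasi_digit (Suc i)" if "j \<le> i" for i using that by (simp add: e'_def)
    have e'_same: "e' i = quasi_digit i" if "i < j + M" for i
    proof (cases "i < j")
      case False
      then have "quasi_digit (j + (i - j)) = 0" "quasi_digit (j + Suc (i - j)) = 0"
        using scaled[of "i - j"] scaled[of "Suc (i - j)"] that by auto
      then show ?thesis using False by (simp add: e'_def)
    qed (simp add: e'_def)
    have "e' \<in> X"
    proof -
      have "range e' \<subseteq> range quasi_digit" by (auto simp: e'_def)
      moreover have "occurs_in w {quasi_digit}" if "occurs_in w {e'}" "w \<in> F" for w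
      proof -
        obtain m where m: "\<And>i. i < length w \<Longrightarrow> e' (m + i) = w ! i"
          using \<open>occurs_in w {e'}\<close> unfolding occurs_in_singleton_iff by blast
        \<comment> \<open>A word of length at most M cannot start before the block of zeros and end after it.\<close>
        show ?thesis
        proof (cases "j \<le> m")
          case True
          then have "quasi_digit (Suc m + i) = w ! i" if "i < length w" for i
            using m[OF that] e'_shift[of "m + i"] by simp
          then show ?thesis unfolding occurs_in_singleton_iff by blast
        next
          case False
          then have "quasi_digit (m + i) = w ! i" if "i < length w" for i
            using m[OF that] e'_same[of "m + i"] M[OF \<open>w \<in> F\<close>] that by simp
          then show ?thesis unfolding occurs_in_singleton_iff by blast
        qed
      qed
      ultimately show ?thesis using e unfolding X_def by auto
    qed
    have tj: "quasi_orbit (Suc j) = \<beta> * quasi_orbit j" using scaled[of 1] by simp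
    \<comment> \<open>Long enough for the prefix of length j + k of the new sequence to have a value above 1 already.\<close>
    obtain k where k: "1 / ((\<beta> - 1) * quasi_orbit j) < \<beta> ^ k"
      using real_arch_pow[OF beta_gt_1] by blast
    have pos: "0 < (\<beta> - 1) * quasi_orbit j" using beta_gt_1 quasi_orbit_range(1) by simp
    obtain x where x: "0 \<le> x" "x < 1" "\<And>i. i < j + k \<Longrightarrow> e' i = beta_digits \<beta> x i"
      using beta_shift_prefix[of e' "j + k"] \<open>e' \<in> X\<close> X by blast
    have "(\<Sum>i<j + k. real (e' i) / \<beta> ^ (i + 1)) = (\<Sum>i<j + k. real (beta_digits \<beta> x i) / \<beta> ^ (i + 1))"
      using x(3) by (intro sum.cong) auto
    also have "\<dots> \<le> x"
      using beta_expansion[OF x(1), of "j + k"]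
        divide_nonneg_pos[OF funpow_beta_map_range(1)[OF x(1,2), of "j + k"], of "\<beta> ^ (j + k)"]
      zero_less_power[OF beta_pos(1), of "j + k"] by linarith
    finally have sum_less: "(\<Sum>i<j + k. real (e' i) / \<beta> ^ (i + 1)) < 1" using x(2) by linarith
    have "(\<Sum>i<j + k. real (e' i) / \<beta> ^ (i + 1))
      = (\<Sum>i<j. real (e' i) / \<beta> ^ (i + 1)) + (\<Sum>i<k. real (e' (j + i)) / \<beta> ^ (j + i + 1))"
      using sum.atLeastLessThan_concat[of 0 j "j + k" "\<lambda>i. real (e' i) / \<beta> ^ (i + 1)"]
        sum.shift_bounds_nat_ivl[of "\<lambda>i. real (e' i) / \<beta> ^ (i + 1)" 0 j k]
      by (simp add: atLeast0LessThan add.commute)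
    also have "(\<Sum>i<j. real (e' i) / \<beta> ^ (i + 1)) = 1 - quasi_orbit j / \<beta> ^ j"
      using quasi_orbit_expansion[of 0 j] by (simp add: quasi_orbit_0 e'_def)
    also have "(\<Sum>i<k. real (e' (j + i)) / \<beta> ^ (j + i + 1))
      = (\<Sum>i<k. real (quasi_digit (Suc j + i)) / \<beta> ^ (i + 1)) / \<beta> ^ j"
      unfolding sum_divide_distrib by (intro sum.cong) (auto simp: e'_shift power_add)
    also have "\<dots> = (\<beta> * quasi_orbit j - quasi_orbit (Suc j + k) / \<beta> ^ k) / \<beta> ^ j"
      using quasi_orbit_expansion[of "Suc j" k] tj by simp
    finally have "(\<beta> * quasi_orbit j - quasi_orbit (Suc j + k) / \<beta> ^ k) / \<beta> ^ j < quasi_orbit j / \<beta> ^ j"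
      using sum_less by simp
    then have "\<beta> * quasi_orbit j - quasi_orbit (Suc j + k) / \<beta> ^ k < quasi_orbit j"
      by (simp add: divide_less_cancel)
    moreover have "quasi_orbit (Suc j + k) / \<beta> ^ k \<le> 1 / \<beta> ^ k"
      using quasi_orbit_range(2) by (intro divide_right_mono) auto
    moreover have "1 / \<beta> ^ k < (\<beta> - 1) * quasi_orbit j" using k pos by (simp add: field_simps)
    ultimately show False by (simp add: left_diff_distrib)
  qed
  then show ?thesis by (intro exI[of _ "1 / \<beta> ^ Suc M"]) auto
qed


section \<open>A uniform proportion of every interval escapes\<close>

lemma full_branch_hits_gap:
  assumes gap: "0 \<le> a\<^sub>0" "a\<^sub>0 < b\<^sub>0" "b\<^sub>0 \<le> 1" "{a\<^sub>0<..<b\<^sub>0} \<inter> Z = {}"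
    and ab: "0 \<le> a" "a < b" "b \<le> 1" and k: "same_digits \<beta> k {a<..<b}"
    and aff: "\<And>y. y \<in> {a<..<b} \<Longrightarrow> (beta_map \<beta> ^^ k) y = \<beta> ^ k * (y - a)"
  obtains n u v where "k \<le> n" "a \<le> u" "u < v" "v \<le> b" "(b\<^sub>0 - a\<^sub>0) / \<beta> * (b - a) \<le> v - u"
    "same_digits \<beta> n {u<..<v}" "(beta_map \<beta> ^^ n) ` {u<..<v} \<inter> Z = {}"
    "\<beta> ^ n * (v - u) = b\<^sub>0 - a\<^sub>0"
proof -
  obtain n where n: "k \<le> n" "1 \<le> \<beta> ^ n * (b - a)" "\<beta> ^ n * (b - a) \<le> \<beta>"
    and sd: "same_digits \<beta> n {a<..<a + 1 / \<beta> ^ n}"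
    and eq: "\<And>y. y \<in> {a<..<a + 1 / \<beta> ^ n} \<Longrightarrow> (beta_map \<beta> ^^ n) y = \<beta> ^ n * (y - a)"
    using full_branch[OF ab k aff] by blast
  define u where "u = a + a\<^sub>0 / \<beta> ^ n"
  define v where "v = a + b\<^sub>0 / \<beta> ^ n"
  have "a \<le> u" using gap by (simp add: u_def)
  have "u < v" using gap by (simp add: u_def v_def divide_strict_right_mono)
  have v: "v \<le> a + 1 / \<beta> ^ n" using gap by (simp add: v_def divide_right_mono)
  have "1 / \<beta> ^ n \<le> b - a" using n(2) by (simp add: field_simps)
  then have "v \<le> b" using v by linarith
  have sub: "{u<..<v} \<subseteq> {a<..<a + 1 / \<beta> ^ n}" using \<open>a \<le> u\<close> v by auto
  have len: "\<beta> ^ n * (v - u) = b\<^sub>0 - a\<^sub>0" by (simp add: u_def v_def algebra_simps)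
  have "(b\<^sub>0 - a\<^sub>0) / \<beta> * (b - a) \<le> v - u"
  proof -
    have "(b - a) / \<beta> \<le> 1 / \<beta> ^ n" using n(3) by (simp add: field_simps)
    then have "(b\<^sub>0 - a\<^sub>0) * ((b - a) / \<beta>) \<le> (b\<^sub>0 - a\<^sub>0) * (1 / \<beta> ^ n)"
      using gap by (intro mult_left_mono) auto
    also have "\<dots> = v - u" by (simp add: u_def v_def diff_divide_distrib)
    finally show ?thesis by simp
  qed
  moreover have "(beta_map \<beta> ^^ n) y \<in> {a\<^sub>0<..<b\<^sub>0}" if y: "y \<in> {u<..<v}" for y
  proof -
    have "a\<^sub>0 / \<beta> ^ n < y - a" "y - a < b\<^sub>0 / \<beta> ^ n" using y by (auto simp: u_def v_def)
    then have "a\<^sub>0 < \<beta> ^ n * (y - a)" "\<beta> ^ n * (y - a) < b\<^sub>0" by (auto simp: field_simps)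
    then show ?thesis using eq[of y] sub y by auto
  qed
  then have "(beta_map \<beta> ^^ n) ` {u<..<v} \<inter> Z = {}" using gap(4) by blast
  ultimately show ?thesis
    using that[of n u v] n(1) \<open>a \<le> u\<close> \<open>u < v\<close> \<open>v \<le> b\<close> same_digits_mono[OF sd order_refl sub] len by blast
qed

lemma escape_via_gap:
  assumes gap: "0 \<le> a\<^sub>0" "a\<^sub>0 < b\<^sub>0" "b\<^sub>0 \<le> 1" "{a\<^sub>0<..<b\<^sub>0} \<inter> Z = {}"
    and ab: "0 \<le> a" "a < b" "b \<le> 1" and k: "same_digits \<beta> k {a<..<b}"
    and aff: "\<And>y. y \<in> {a<..<b} \<Longrightarrow> (beta_map \<beta> ^^ k) y = \<beta> ^ k * (y - a)"
    and pq: "p \<le> a" "b \<le> q" "\<And>m. same_digits \<beta> m {p<..<q} \<Longrightarrow> m < k"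
    and c: "c * (q - p) \<le> (b\<^sub>0 - a\<^sub>0) / \<beta> * (b - a)" "c \<le> b\<^sub>0 - a\<^sub>0"
  shows "\<exists>n u v. escape \<beta> c Z p q n u v"
proof -
  obtain n u v where *: "k \<le> n" "a \<le> u" "u < v" "v \<le> b" "(b\<^sub>0 - a\<^sub>0) / \<beta> * (b - a) \<le> v - u"
    "same_digits \<beta> n {u<..<v}" "(beta_map \<beta> ^^ n) ` {u<..<v} \<inter> Z = {}"
    "\<beta> ^ n * (v - u) = b\<^sub>0 - a\<^sub>0"
    using full_branch_hits_gap[OF gap ab k aff] by blast
  have "escape \<beta> c Z p q n u v"
    unfolding escape_def
  proof (intro conjI allI impI)
    show "p \<le> u" "v \<le> q" "c * (q - p) \<le> v - u" using * pq c by linarith+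
    show "m < n" if "same_digits \<beta> m {p<..<q}" for m using pq(3)[OF that] *(1) by linarith
    show "c \<le> \<beta> ^ n * (v - u) \<or> (\<forall>y\<in>{u<..<v}. 1 - \<beta> ^ n * (v - u) \<le> (beta_map \<beta> ^^ n) y)"
      using *(8) c(2) by simp
  qed (use * in auto)
  then show ?thesis by blast
qed

text \<open>
  The larger of the two sides of the first cut is used: the right one expands to a full branch, and
  the image of the left one ends at 1, where it is off Z after truncation to length \<kappa>.
\<close>

lemma uniform_escape_away_from_one:
  assumes gap: "0 \<le> a\<^sub>0" "a\<^sub>0 < b\<^sub>0" "b\<^sub>0 \<le> 1" "{a\<^sub>0<..<b\<^sub>0} \<inter> Z = {}"
    and \<kappa>: "\<kappa> > 0" "{1 - \<kappa><..<1} \<inter> Z = {}"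
  shows "\<exists>c>0. \<forall>p q. 0 \<le> p \<longrightarrow> p < q \<longrightarrow> q \<le> 1 \<longrightarrow> (\<exists>n u v. escape \<beta> c Z p q n u v)"
proof -
  define \<mu> where "\<mu> = min \<kappa> 1"
  have \<mu>: "0 < \<mu>" "\<mu> \<le> 1" using \<kappa> by (auto simp: \<mu>_def)
  have "{1 - \<mu><..<1} \<subseteq> {1 - \<kappa><..<1}" by (auto simp: \<mu>_def)
  then have avoid: "{1 - \<mu><..<1} \<inter> Z = {}" using \<kappa>(2) by blast
  define c where "c = min ((b\<^sub>0 - a\<^sub>0) / (2 * \<beta>)) (min (1 / 2) (\<mu> / \<beta>))"
  have "c > 0" using gap \<mu> by (simp add: c_def)
  have c: "c \<le> (b\<^sub>0 - a\<^sub>0) / (2 * \<beta>)" "c \<le> 1 / 2" "c \<le> \<mu> / \<beta>"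
    unfolding c_def by (rule min.cobounded1, rule min.coboundedI2[OF min.cobounded1],
      rule min.coboundedI2[OF min.cobounded2])
  have "(b\<^sub>0 - a\<^sub>0) / (2 * \<beta>) \<le> (b\<^sub>0 - a\<^sub>0) / 1"
    by (rule divide_left_mono) (use gap beta_gt_1 in \<open>linarith | simp\<close>)+
  then have c0: "c \<le> b\<^sub>0 - a\<^sub>0" using c(1) by simp
  have "\<exists>n u v. escape \<beta> c Z p q n u v" if pq: "0 \<le> p" "p < q" "q \<le> 1" for p q
  proof -
    obtain m a Q where m: "same_digits \<beta> m {p<..<q}" "\<And>k. same_digits \<beta> k {p<..<q} \<Longrightarrow> k \<le> m"
      and a: "p < a" "a < q"
      and right: "same_digits \<beta> (Suc m) {a<..<q}"
        "\<And>y. y \<in> {a<..<q} \<Longrightarrow> (beta_map \<beta> ^^ Suc m) y = \<beta> ^ Suc m * (y - a)"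
      and left: "same_digits \<beta> (Suc m) {max p (a - 1 / \<beta> ^ Suc m)<..<a}"
        "\<And>y. y \<in> {max p (a - 1 / \<beta> ^ Suc m)<..<a} \<Longrightarrow>
          (beta_map \<beta> ^^ Suc m) y = 1 - \<beta> ^ Suc m * (a - y)"
      using first_cut[OF pq] by metis
    show ?thesis
    proof (cases "(q - p) / 2 \<le> q - a")
      case True
      have "c * (q - p) \<le> (b\<^sub>0 - a\<^sub>0) / (2 * \<beta>) * (q - p)" using c(1) pq by (intro mult_right_mono) auto
      also have "\<dots> = (b\<^sub>0 - a\<^sub>0) / \<beta> * ((q - p) / 2)" by simp
      also have "\<dots> \<le> (b\<^sub>0 - a\<^sub>0) / \<beta> * (q - a)" using True gap by (intro mult_left_mono) auto
      finally show ?thesis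
        using m(2) a pq c0 by (intro escape_via_gap[OF gap _ a(2) pq(3) right]) (auto simp: less_Suc_eq_le)
    next
      case False
      then have half: "(q - p) / 2 \<le> a - p" by (simp add: field_simps)
      define u where "u = max p (a - \<mu> / \<beta> ^ Suc m)"
      have "\<mu> / \<beta> ^ Suc m \<le> 1 / \<beta> ^ Suc m" using \<mu> by (intro divide_right_mono) auto
      then have sub: "{u<..<a} \<subseteq> {max p (a - 1 / \<beta> ^ Suc m)<..<a}" by (auto simp: u_def)
      have f: "(beta_map \<beta> ^^ Suc m) y = 1 - \<beta> ^ Suc m * (a - y)" if "y \<in> {u<..<a}" for y
        using left(2) sub that by blast
      have "0 < \<mu> / \<beta> ^ Suc m" using \<mu> by simp
      then have "u < a" using a by (simp add: u_def)
      have "escape \<beta> c Z p q (Suc m) u a"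
        unfolding escape_def
      proof (intro conjI allI impI)
        show "p \<le> u" by (simp add: u_def)
        show "c * (q - p) \<le> a - u"
        proof -
          have "c * (q - p) \<le> 1 / 2 * (q - p)" using c(2) pq by (intro mult_right_mono) auto
          then have 1: "c * (q - p) \<le> a - p" using half by linarith
          have "q - p \<le> 1 / \<beta> ^ m" using same_digits_length[OF m(1) pq] by (simp add: field_simps)
          then have "c * (q - p) \<le> \<mu> / \<beta> * (1 / \<beta> ^ m)"
            using c(3) \<open>c > 0\<close> pq by (intro mult_mono) auto
          then have "c * (q - p) \<le> \<mu> / \<beta> ^ Suc m" by simp
          with 1 show ?thesis by (simp add: u_def max_def)
        qed
        show "k < Suc m" if "same_digits \<beta> k {p<..<q}" for k using m(2)[OF that] by simp
        show "(beta_map \<beta> ^^ Suc m) ` {u<..<a} \<inter> Z = {}"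
        proof -
          have "(beta_map \<beta> ^^ Suc m) y \<in> {1 - \<mu><..<1}" if y: "y \<in> {u<..<a}" for y
          proof -
            have "a - y < \<mu> / \<beta> ^ Suc m" using y by (auto simp: u_def)
            then have "\<beta> ^ Suc m * (a - y) < \<mu>" by (simp add: field_simps)
            moreover have "0 < \<beta> ^ Suc m * (a - y)" using y by simp
            ultimately show ?thesis unfolding f[OF y] by simp
          qed
          then show ?thesis using avoid by blast
        qed
        have "1 - \<beta> ^ Suc m * (a - u) \<le> (beta_map \<beta> ^^ Suc m) y" if y: "y \<in> {u<..<a}" for y
        proof -
          have "\<beta> ^ Suc m * (a - y) \<le> \<beta> ^ Suc m * (a - u)"
            using y by (intro mult_left_mono) auto
          then show ?thesis unfolding f[OF y] by linarith
        qed
        then show "c \<le> \<beta> ^ Suc m * (a - u) \<or>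
          (\<forall>y\<in>{u<..<a}. 1 - \<beta> ^ Suc m * (a - u) \<le> (beta_map \<beta> ^^ Suc m) y)" by blast
      qed (use \<open>u < a\<close> a same_digits_mono[OF left(1) order_refl sub] in auto)
      then show ?thesis by blast
    qed
  qed
  then show ?thesis using \<open>c > 0\<close> by blast
qed

text \<open>
  If the left side of the first cut is the larger one, it is cut a second time. Its image ends at 1,
  so until then the right end of its image runs through the quasi-greedy orbit of 1, and the right
  side of the second cut has an image of length at least \<tau> at the time of that cut.
\<close>

lemma uniform_escape_quasi_orbit_bounded_below:
  assumes gap: "0 \<le> a\<^sub>0" "a\<^sub>0 < b\<^sub>0" "b\<^sub>0 \<le> 1" "{a\<^sub>0<..<b\<^sub>0} \<inter> Z = {}"
    and \<tau>: "\<tau> > 0" "\<And>j. \<tau> \<le> quasi_orbit j"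
  shows "\<exists>c>0. \<forall>p q. 0 \<le> p \<longrightarrow> p < q \<longrightarrow> q \<le> 1 \<longrightarrow> (\<exists>n u v. escape \<beta> c Z p q n u v)"
proof -
  \<comment> \<open>Proportion of the left side of a cut once its image has been truncated to length 1.\<close>
  define d where "d = min (1 / 2) (1 / \<beta>)"
  have d: "0 < d" "d \<le> 1 / 2" "d \<le> 1 / \<beta>"
    unfolding d_def by (simp, rule min.cobounded1, rule min.cobounded2)
  define c where "c = (b\<^sub>0 - a\<^sub>0) / \<beta> * min (1 / 2) (\<tau> / \<beta> * d)"
  have "c > 0" using gap \<tau> d by (simp add: c_def)
  have pos: "0 < (b\<^sub>0 - a\<^sub>0) / \<beta>" using gap by simp
  have c: "c * L \<le> (b\<^sub>0 - a\<^sub>0) / \<beta> * l" if "1 / 2 * L \<le> l \<or> \<tau> / \<beta> * d * L \<le> l" "0 \<le> L" for L l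
  proof -
    have "min (1 / 2) (\<tau> / \<beta> * d) * L \<le> 1 / 2 * L" "min (1 / 2) (\<tau> / \<beta> * d) * L \<le> \<tau> / \<beta> * d * L"
      by (rule mult_right_mono[OF min.cobounded1 that(2)], rule mult_right_mono[OF min.cobounded2 that(2)])
    then have "min (1 / 2) (\<tau> / \<beta> * d) * L \<le> l" using that(1) by linarith
    then show ?thesis using mult_left_mono[OF _ less_imp_le[OF pos]] unfolding c_def mult.assoc by blast
  qed
  have "c \<le> (b\<^sub>0 - a\<^sub>0) / \<beta>" using c[of 1 1] by simp
  also have "\<dots> \<le> (b\<^sub>0 - a\<^sub>0) / 1"
    by (rule divide_left_mono) (use gap in simp_all)
  finally have c0: "c \<le> b\<^sub>0 - a\<^sub>0" by simp
  have "\<exists>n u v. escape \<beta> c Z p q n u v" if pq: "0 \<le> p" "p < q" "q \<le> 1" for p q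
  proof -
    obtain m a Q where m: "same_digits \<beta> m {p<..<q}" "\<And>k. same_digits \<beta> k {p<..<q} \<Longrightarrow> k \<le> m"
      and a: "p < a" "a < q"
      and right: "same_digits \<beta> (Suc m) {a<..<q}"
        "\<And>y. y \<in> {a<..<q} \<Longrightarrow> (beta_map \<beta> ^^ Suc m) y = \<beta> ^ Suc m * (y - a)"
      and left: "same_digits \<beta> (Suc m) {max p (a - 1 / \<beta> ^ Suc m)<..<a}"
        "\<And>y. y \<in> {max p (a - 1 / \<beta> ^ Suc m)<..<a} \<Longrightarrow>
          (beta_map \<beta> ^^ Suc m) y = 1 - \<beta> ^ Suc m * (a - y)"
      using first_cut[OF pq] by metis
    show ?thesis
    proof (cases "(q - p) / 2 \<le> q - a")
      case True
      have "c * (q - p) \<le> (b\<^sub>0 - a\<^sub>0) / \<beta> * (q - a)" using True pq by (intro c) auto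
      then show ?thesis
        using m(2) a pq c0 by (intro escape_via_gap[OF gap _ a(2) pq(3) right]) (auto simp: less_Suc_eq_le)
    next
      case False
      define p' where "p' = max p (a - 1 / \<beta> ^ Suc m)"
      note left = left[folded p'_def]
      have p': "0 \<le> p'" "p' < a" "a \<le> 1" using pq a by (auto simp: p'_def)
      have len: "d * (q - p) \<le> a - p'"
      proof -
        have "d * (q - p) \<le> 1 / 2 * (q - p)" using d(2) pq by (intro mult_right_mono) auto
        moreover have "(q - p) / 2 \<le> a - p" using False by (simp add: field_simps)
        ultimately have 1: "d * (q - p) \<le> a - p" by simp
        have "q - p \<le> 1 / \<beta> ^ m" using same_digits_length[OF m(1) pq] by (simp add: field_simps)
        then have "d * (q - p) \<le> 1 / \<beta> * (1 / \<beta> ^ m)"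
          using d pq by (intro mult_mono) auto
        then have "d * (q - p) \<le> 1 / \<beta> ^ Suc m" by simp
        with 1 show ?thesis by (simp add: p'_def max_def)
      qed
      obtain m' a' Q' where m': "same_digits \<beta> m' {p'<..<a}" "\<And>k. same_digits \<beta> k {p'<..<a} \<Longrightarrow> k \<le> m'"
        and a': "p' < a'" "a' < a"
        and aff: "\<And>y. y \<in> {p'<..<a} \<Longrightarrow> (beta_map \<beta> ^^ m') y = Q' - \<beta> ^ m' * (a - y)"
        and gQ: "\<beta> ^ Suc m' * (a - a') = quasi_step Q'"
        and right': "same_digits \<beta> (Suc m') {a'<..<a}"
          "\<And>y. y \<in> {a'<..<a} \<Longrightarrow> (beta_map \<beta> ^^ Suc m') y = \<beta> ^ Suc m' * (y - a')"
        using first_cut[OF p'] by metis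
      have "Suc m \<le> m'" using m'(2)[OF left(1)] .
      define l where "l = m' - Suc m"
      \<comment> \<open>Both numbers are the left limit of f^m' at a; comparing them at one point y near a suffices.\<close>
      have Q': "Q' = quasi_orbit l"
      proof -
        obtain \<eta> where \<eta>: "\<eta> > 0" and near: "\<And>y. 1 - \<eta> < y \<Longrightarrow> y < 1 \<Longrightarrow>
            (beta_map \<beta> ^^ l) y = quasi_orbit l - \<beta> ^ l * (1 - y)"
          using left_of_one[of l] by metis
        define y where "y = max ((p' + a) / 2) (a - \<eta> / (2 * \<beta> ^ Suc m))"
        have "0 < \<eta> / (2 * \<beta> ^ Suc m)" using \<eta> by simp
        moreover have "p' < (p' + a) / 2" "(p' + a) / 2 < a" using p'(2) by (simp_all add: field_simps)
        ultimately have y: "y \<in> {p'<..<a}" unfolding y_def by (simp add: less_max_iff_disj)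
        have "a - y \<le> \<eta> / (2 * \<beta> ^ Suc m)" by (auto simp: y_def)
        then have "\<beta> ^ Suc m * (a - y) \<le> \<eta> / 2" by (simp add: field_simps)
        moreover have "0 < \<beta> ^ Suc m * (a - y)" using y by simp
        ultimately have "(beta_map \<beta> ^^ l) ((beta_map \<beta> ^^ Suc m) y)
            = quasi_orbit l - \<beta> ^ l * (1 - (beta_map \<beta> ^^ Suc m) y)"
          using \<eta> unfolding left(2)[OF y] by (intro near) linarith+
        also have "\<dots> = quasi_orbit l - \<beta> ^ l * (\<beta> ^ Suc m * (a - y))" unfolding left(2)[OF y] by simp
        also have "\<beta> ^ l * (\<beta> ^ Suc m * (a - y)) = \<beta> ^ m' * (a - y)"
          using \<open>Suc m \<le> m'\<close> unfolding l_def mult.assoc[symmetric] power_add[symmetric] by simp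
        finally have eq: "(beta_map \<beta> ^^ (l + Suc m)) y = quasi_orbit l - \<beta> ^ m' * (a - y)"
          by (simp only: funpow_add comp_apply)
        have "l + Suc m = m'" using \<open>Suc m \<le> m'\<close> by (simp add: l_def)
        from aff[OF y] eq[unfolded this] show ?thesis by linarith
      qed
      have "\<tau> \<le> \<beta> ^ Suc m' * (a - a')" unfolding gQ Q' quasi_orbit_Suc[symmetric] by (rule \<tau>(2))
      then have "\<tau> / \<beta> ^ Suc m' \<le> a - a'" by (simp add: field_simps)
      moreover have "a - p' \<le> 1 / \<beta> ^ m'" using same_digits_length[OF m'(1) p'] by (simp add: field_simps)
      then have "\<tau> / \<beta> * (a - p') \<le> \<tau> / \<beta> * (1 / \<beta> ^ m')" using \<tau> by (intro mult_left_mono) auto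
      moreover have "\<tau> / \<beta> * (d * (q - p)) \<le> \<tau> / \<beta> * (a - p')" using len \<tau> by (intro mult_left_mono) auto
      ultimately have "\<tau> / \<beta> * d * (q - p) \<le> a - a'" by simp
      then have "c * (q - p) \<le> (b\<^sub>0 - a\<^sub>0) / \<beta> * (a - a')" using pq by (intro c) auto
      moreover have "k < Suc m'" if "same_digits \<beta> k {p<..<q}" for k
        using m(2)[OF that] \<open>Suc m \<le> m'\<close> by simp
      moreover have "p \<le> a'" using a'(1) by (simp add: p'_def)
      ultimately show ?thesis
        using a a' p' c0 by (intro escape_via_gap[OF gap _ a'(2) p'(3) right']) auto
    qed
  qed
  then show ?thesis using \<open>c > 0\<close> by blast
qed


section \<open>The game\<close>

lemma left_of_one_same_digits:
  "\<exists>\<eta>>0. same_digits \<beta> n {1 - \<eta><..<1}"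
proof -
  obtain \<eta> where \<eta>: "\<eta> > 0"
    and *: "\<And>y i. 1 - \<eta> < y \<Longrightarrow> y < 1 \<Longrightarrow> i < n \<Longrightarrow> beta_digits \<beta> y i = quasi_digit i"
    using left_of_one[of n] by metis
  have "same_digits \<beta> n {1 - \<eta><..<1}" unfolding same_digits_def using * by simp
  with \<eta> show ?thesis by blast
qed

lemma same_digits_funpow_append:
  assumes "same_digits \<beta> n I" "same_digits \<beta> l ((beta_map \<beta> ^^ n) ` I)"
  shows "same_digits \<beta> (n + l) I"
  unfolding same_digits_def
proof (intro allI impI ballI)
  fix i x y assume i: "i < n + l" and xy: "x \<in> I" "y \<in> I"
  show "beta_digits \<beta> x i = beta_digits \<beta> y i"
  proof (cases "i < n")
    case True then show ?thesis using same_digitsD[OF assms(1)] xy by blast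
  next
    case False
    then have "beta_digits \<beta> ((beta_map \<beta> ^^ n) x) (i - n) = beta_digits \<beta> ((beta_map \<beta> ^^ n) y) (i - n)"
      using i xy by (intro same_digitsD[OF assms(2)]) auto
    then show ?thesis using False by (simp add: beta_digits_funpow)
  qed
qed

text \<open>
  In one turn the length of the image, \<beta>^n (v - u), can drop by a factor \<rho>. If it is below both
  c and \<eta>, then by the last clause of the escape condition the image lies in (1 - \<eta>, 1),
  where the next J digits are constant. So the next escape time is later by more than J, and J is
  chosen such that this gain outweighs \<rho>. Hence the length can fall below the threshold \<theta> only if it
  starts there, and then it does not decrease. The bound x depends on the play through the first
  move, which is harmless: the orbit closure of a single point is at stake.
\<close>

lemma escape_sequence_scale_bounded_below:
  assumes c: "0 < c" and \<rho>: "0 < \<rho>"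
    and uv: "\<And>k. 0 \<le> u k" "\<And>k. v k \<le> 1"
    and pq: "\<And>k. u k \<le> p (Suc k)" "\<And>k. q (Suc k) \<le> v k"
    and shrink: "\<And>k. \<rho> * (v k - u k) \<le> v (Suc k) - u (Suc k)"
    and esc: "\<And>k. escape \<beta> c Z (p k) (q k) (n k) (u k) (v k)"
  shows "\<exists>x>0. \<forall>k. x \<le> \<beta> ^ n k * (v k - u k)"
proof -
  define X where "X k = \<beta> ^ n k * (v k - u k)" for k
  have uv_less: "u k < v k" for k using esc[of k] by (simp add: escape_def)
  have X_pos: "0 < X k" for k using uv_less[of k] by (simp add: X_def)
  have sd: "same_digits \<beta> (n k) {u k<..<v k}" for k using esc[of k] by (simp add: escape_def)
  have sub: "{p (Suc k)<..<q (Suc k)} \<subseteq> {u k<..<v k}" for k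
    using pq[of k] by auto
  have later: "m < n (Suc k)" if "same_digits \<beta> m {u k<..<v k}" for m k
    using same_digits_mono[OF that order_refl sub] esc[of "Suc k"] unfolding escape_def by blast
  obtain J where J: "1 / \<rho> < \<beta> ^ J" using real_arch_pow[OF beta_gt_1] by blast
  obtain \<eta> where \<eta>: "\<eta> > 0" "same_digits \<beta> J {1 - \<eta><..<1}" using left_of_one_same_digits by blast
  define \<theta> where "\<theta> = \<rho> * min c \<eta>"
  have "\<theta> > 0" using \<rho> c \<eta> by (simp add: \<theta>_def)
  have step: "min (X k) \<theta> \<le> X (Suc k)" for k
  proof -
    have grow: "\<rho> * (\<beta> ^ i * X k) \<le> X (Suc k)" if "n k + i \<le> n (Suc k)" for i
    proof -
      have "\<rho> * (\<beta> ^ i * X k) = \<beta> ^ (n k + i) * (\<rho> * (v k - u k))"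
        by (simp add: X_def power_add)
      also have "\<dots> \<le> \<beta> ^ n (Suc k) * (v (Suc k) - u (Suc k))"
        using that shrink[of k] \<rho> uv_less[of k] by (intro mult_mono power_increasing) auto
      finally show ?thesis by (simp add: X_def)
    qed
    show ?thesis
    proof (cases "min c \<eta> \<le> X k")
      case True
      have "\<theta> \<le> \<rho> * X k" unfolding \<theta>_def using True \<rho> by (intro mult_left_mono) auto
      also have "\<dots> \<le> X (Suc k)" using grow[of 0] later[OF sd[of k]] by simp
      finally show ?thesis by (rule min.coboundedI2)
    next
      case False
      then have "X k < c" "X k < \<eta>" by (auto simp: min_def split: if_splits)
      have near: "1 - X k \<le> (beta_map \<beta> ^^ n k) y" if "y \<in> {u k<..<v k}" for y
        using esc[of k] \<open>X k < c\<close> that unfolding escape_def X_def by auto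
      have "(beta_map \<beta> ^^ n k) ` {u k<..<v k} \<subseteq> {1 - \<eta><..<1}"
      proof
        fix z assume "z \<in> (beta_map \<beta> ^^ n k) ` {u k<..<v k}"
        then obtain y where y: "y \<in> {u k<..<v k}" "z = (beta_map \<beta> ^^ n k) y" by blast
        have "z < 1" unfolding y(2) using y(1) uv[of k] by (intro funpow_beta_map_range) auto
        moreover have "1 - \<eta> < z" using near[OF y(1)] \<open>X k < \<eta>\<close> y(2) by linarith
        ultimately show "z \<in> {1 - \<eta><..<1}" by simp
      qed
      then have "same_digits \<beta> (n k + J) {u k<..<v k}"
        by (intro same_digits_funpow_append[OF sd] same_digits_mono[OF \<eta>(2) order_refl])
      then have "\<rho> * (\<beta> ^ J * X k) \<le> X (Suc k)" using later[of "n k + J" k] by (intro grow) simp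
      moreover have "1 < \<rho> * \<beta> ^ J" using J \<rho> by (simp add: field_simps)
      then have "1 * X k \<le> \<rho> * \<beta> ^ J * X k" using X_pos[of k] by (intro mult_right_mono) auto
      ultimately have "X k \<le> X (Suc k)" by (simp add: mult.assoc)
      then show ?thesis by (rule min.coboundedI1)
    qed
  qed
  have "min (X 0) \<theta> \<le> X k" for k
  proof (induction k)
    case (Suc k)
    then have "min (X 0) \<theta> \<le> min (X k) \<theta>" by simp
    with step[of k] show ?case by (rule order_trans[rotated])
  qed simp
  moreover have "0 < min (X 0) \<theta>" using X_pos \<open>\<theta> > 0\<close> by simp
  ultimately show ?thesis unfolding X_def by blast
qed

text \<open>
  For a given m let k be the first turn with m \<le> n k. Then f^m maps (u k, v k) off Z, and y is in
  the middle third, so f^m y is at distance at least \<beta>^m (v k - u k) / 3 from Z. This is bounded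
  below because m exceeds the previous escape time (or k = 0).
\<close>

lemma escape_sequence_orbit_avoids:
  assumes X: "X \<subseteq> beta_shift \<beta>" and shift: "\<And>s l. s \<in> X \<Longrightarrow> (\<lambda>i. s (l + i)) \<in> X"
    and c: "0 < c" and \<rho>: "0 < \<rho>"
    and uv: "\<And>k. 0 \<le> u k" "\<And>k. v k \<le> 1"
    and pq: "\<And>k. u k \<le> p (Suc k)" "\<And>k. q (Suc k) \<le> v k"
    and shrink: "\<And>k. \<rho> * (v k - u k) \<le> v (Suc k) - u (Suc k)"
    and esc: "\<And>k. escape \<beta> c (beta_value \<beta> ` X) (p k) (q k) (n k) (u k) (v k)"
    and y: "\<And>k. u k + (v k - u k) / 3 \<le> y" "\<And>k. y \<le> v k - (v k - u k) / 3"
  shows "y \<in> orbit_avoiding (beta_map \<beta>) (beta_value \<beta> ` X)"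
proof -
  let ?Z = "beta_value \<beta> ` X"
  obtain x where x: "x > 0" "\<And>k. x \<le> \<beta> ^ n k * (v k - u k)"
    using escape_sequence_scale_bounded_below[where u = u and v = v and p = p and q = q and n = n,
      OF c \<rho> uv pq shrink esc] by blast
  have uv_less: "u k < v k" for k using esc[of k] by (simp add: escape_def)
  have sd: "same_digits \<beta> (n k) {u k<..<v k}" for k using esc[of k] by (simp add: escape_def)
  have yk: "y \<in> {u k<..<v k}" for k using y[of k] uv_less[of k] by (simp add: field_simps)
  have n_less: "n k < n (Suc k)" for k
  proof -
    have "{p (Suc k)<..<q (Suc k)} \<subseteq> {u k<..<v k}" using pq[of k] by auto
    from same_digits_mono[OF sd order_refl this] show ?thesis
      using esc[of "Suc k"] unfolding escape_def by blast
  qed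
  have n_ge: "k \<le> n k" for k
    by (rule strict_mono_imp_increasing) (use n_less in \<open>simp add: strict_mono_Suc_iff\<close>)
  define \<delta> where "\<delta> = min (v 0 - u 0) (\<rho> * x) / 3"
  have "\<delta> > 0" using uv_less[of 0] \<rho> x(1) by (simp add: \<delta>_def)
  have avoid: "\<delta> \<le> \<bar>(beta_map \<beta> ^^ m) y - z\<bar>" if z: "z \<in> ?Z" for m z
  proof -
    define k where "k = (LEAST k. m \<le> n k)"
    have k: "m \<le> n k" unfolding k_def by (rule LeastI[of _ m]) (rule n_ge)
    have "(beta_map \<beta> ^^ n k) ` {u k<..<v k} \<inter> ?Z = {}" using esc[of k] by (simp add: escape_def)
    from image_avoids_earlier[OF X shift uv sd this k]
    have "z \<notin> (beta_map \<beta> ^^ m) ` {u k<..<v k}" using z by blast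
    then have out: "z \<le> (beta_map \<beta> ^^ m) y - \<beta> ^ m * (y - u k)
        \<or> (beta_map \<beta> ^^ m) y + \<beta> ^ m * (v k - y) \<le> z"
      unfolding image_open_interval[OF same_digits_mono[OF sd k order_refl] uv(1) yk] by auto
    have "min (v 0 - u 0) (\<rho> * x) \<le> \<beta> ^ m * (v k - u k)"
    proof (cases k)
      case 0
      have "1 * (v 0 - u 0) \<le> \<beta> ^ m * (v 0 - u 0)"
        using uv_less[of 0] by (intro mult_right_mono) auto
      then show ?thesis unfolding 0 by (intro min.coboundedI1) simp
    next
      case (Suc k')
      then have "\<not> m \<le> n k'" using not_less_Least[of k' "\<lambda>k. m \<le> n k"] unfolding k_def by simp
      then have "\<beta> ^ n k' \<le> \<beta> ^ m" by (intro power_increasing) auto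
      have "\<rho> * x \<le> \<rho> * (\<beta> ^ n k' * (v k' - u k'))" using x(2) \<rho> by (intro mult_left_mono) auto
      also have "\<dots> = \<beta> ^ n k' * (\<rho> * (v k' - u k'))" by simp
      also have "\<dots> \<le> \<beta> ^ m * (v k - u k)"
        unfolding Suc using shrink[of k'] \<open>\<beta> ^ n k' \<le> \<beta> ^ m\<close> \<rho> uv_less[of k'] by (intro mult_mono) auto
      finally show ?thesis by (rule min.coboundedI2)
    qed
    then have \<delta>: "\<delta> \<le> \<beta> ^ m * ((v k - u k) / 3)" by (simp add: \<delta>_def)
    have "\<beta> ^ m * ((v k - u k) / 3) \<le> \<beta> ^ m * (y - u k)"
      by (rule mult_left_mono) (use y(1)[of k] in \<open>simp_all add: field_simps\<close>)
    moreover have "\<beta> ^ m * ((v k - u k) / 3) \<le> \<beta> ^ m * (v k - y)"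
      by (rule mult_left_mono) (use y(2)[of k] in \<open>simp_all add: field_simps\<close>)
    ultimately show ?thesis using out \<delta> by linarith
  qed
  have "?Z \<inter> closure (\<Union>m. {(beta_map \<beta> ^^ m) y}) = {}"
  proof (rule ccontr)
    assume "\<not> ?thesis"
    then obtain z where z: "z \<in> ?Z" "z \<in> closure (\<Union>m. {(beta_map \<beta> ^^ m) y})" by blast
    then obtain w where "w \<in> (\<Union>m. {(beta_map \<beta> ^^ m) y})" "dist w z < \<delta>"
      using closure_approachable \<open>\<delta> > 0\<close> by blast
    then show False using avoid[OF z(1)] by (auto simp: dist_real_def not_le[symmetric])
  qed
  moreover have "y \<in> {0..<1}" using yk[of 0] uv[of 0] by auto
  ultimately show ?thesis unfolding orbit_avoiding_def by simp
qed

text \<open>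
  White's strategy is positional: it answers with the middle third of an escaping subinterval of
  Black's last interval. The parameter c does not depend on Black's \<gamma>; only the distance to Z
  does.
\<close>

lemma uniform_escape_imp_winning:
  assumes X: "X \<subseteq> beta_shift \<beta>" and shift: "\<And>s l. s \<in> X \<Longrightarrow> (\<lambda>i. s (l + i)) \<in> X"
    and c: "0 < c"
    and escapes: "\<And>p q. 0 \<le> p \<Longrightarrow> p < q \<Longrightarrow> q \<le> 1 \<Longrightarrow> \<exists>n u v. escape \<beta> c (beta_value \<beta> ` X) p q n u v"
  shows "winning (c / 3) (orbit_avoiding (beta_map \<beta>) (beta_value \<beta> ` X))"
proof -
  let ?Z = "beta_value \<beta> ` X"
  obtain N U V where esc: "\<And>p q. 0 \<le> p \<Longrightarrow> p < q \<Longrightarrow> q \<le> 1 \<Longrightarrow> escape \<beta> c ?Z p q (N p q) (U p q) (V p q)"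
    using escapes by metis
  define W where "W I = {U (Inf I) (Sup I) + (V (Inf I) (Sup I) - U (Inf I) (Sup I)) / 3 ..
      V (Inf I) (Sup I) - (V (Inf I) (Sup I) - U (Inf I) (Sup I)) / 3}" for I
  define \<sigma> :: strategy where "\<sigma> Bs = W (last Bs)" for Bs
  have move: "white_move \<sigma> B k = W (B k)" for B k
    by (simp add: white_move_def \<sigma>_def)
  have W_eq: "W {p..q} = {U p q + (V p q - U p q) / 3 .. V p q - (V p q - U p q) / 3}" if "p < q" for p q
    using that by (simp add: W_def)
  have W: "closed_interval (W {p..q})" "W {p..q} \<subseteq> {p..q}" "len (W {p..q}) = (V p q - U p q) / 3"
    "c * (q - p) \<le> V p q - U p q"
    if "0 \<le> p" "p < q" "q \<le> 1" for p q
  proof -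
    have *: "p \<le> U p q" "U p q < V p q" "V p q \<le> q" "c * (q - p) \<le> V p q - U p q"
      using esc[OF that] by (auto simp: escape_def)
    then have less: "U p q + (V p q - U p q) / 3 < V p q - (V p q - U p q) / 3" by (simp add: field_simps)
    then show "closed_interval (W {p..q})" unfolding W_eq[OF that(2)] closed_interval_def by blast
    show "W {p..q} \<subseteq> {p..q}" unfolding W_eq[OF that(2)] using * by (auto simp: field_simps)
    show "len (W {p..q}) = (V p q - U p q) / 3" unfolding W_eq[OF that(2)] using less by (simp add: field_simps)
    show "c * (q - p) \<le> V p q - U p q" by fact
  qed
  have interval: "\<exists>p q. 0 \<le> p \<and> p < q \<and> q \<le> 1 \<and> B k = {p..q}"
    if "\<And>j. j \<le> k \<Longrightarrow> black_legal \<gamma> \<sigma> B j" for \<gamma> B k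
    using that
  proof (induction k)
    case 0
    then have "closed_interval (B 0)" "B 0 \<subseteq> {0..1}" using 0[of 0] by auto
    then show ?case unfolding closed_interval_def by force
  next
    case (Suc k)
    then obtain p q where pq: "0 \<le> p" "p < q" "q \<le> 1" "B k = {p..q}" by (metis le_SucI)
    have "closed_interval (B (Suc k))" "B (Suc k) \<subseteq> W {p..q}"
      using Suc.prems[of "Suc k"] pq(4) by (auto simp: move)
    then obtain p' q' where "p' < q'" "B (Suc k) = {p'..q'}" "{p'..q'} \<subseteq> {p..q}"
      unfolding closed_interval_def using W(2)[OF pq(1-3)] by blast
    then show ?case using pq by (intro exI[of _ p'] exI[of _ q']) auto
  qed
  have "winning2 (c / 3) \<gamma> (orbit_avoiding (beta_map \<beta>) ?Z)" if \<gamma>: "0 < \<gamma>" "\<gamma> < 1" for \<gamma>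
    unfolding winning2_def
  proof (intro exI[of _ \<sigma>] allI conjI impI)
    fix B k assume "\<forall>j\<le>k. black_legal \<gamma> \<sigma> B j"
    then obtain p q where pq: "0 \<le> p" "p < q" "q \<le> 1" "B k = {p..q}" using interval by metis
    show "white_legal (c / 3) \<sigma> B k"
      unfolding white_legal_def move pq(4) using W[OF pq(1-3)] pq(2) by simp
  next
    fix B assume legal: "\<forall>k. black_legal \<gamma> \<sigma> B k"
    then have "\<forall>k. \<exists>p q. 0 \<le> p \<and> p < q \<and> q \<le> 1 \<and> B k = {p..q}" using interval by blast
    then obtain p q where pq: "\<And>k. 0 \<le> p k" "\<And>k. p k < q k" "\<And>k. q k \<le> 1" "\<And>k. B k = {p k..q k}"
      by metis
    define n where "n k = N (p k) (q k)" for k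
    define u where "u k = U (p k) (q k)" for k
    define v where "v k = V (p k) (q k)" for k
    have E: "escape \<beta> c ?Z (p k) (q k) (n k) (u k) (v k)" for k
      unfolding n_def u_def v_def by (rule esc[OF pq(1-3)])
    have uv: "p k \<le> u k" "u k < v k" "v k \<le> q k" "c * (q k - p k) \<le> v k - u k" for k
      using E[of k] by (auto simp: escape_def)
    have Wk: "white_move \<sigma> B k = {u k + (v k - u k) / 3 .. v k - (v k - u k) / 3}" for k
      unfolding move pq(4) W_eq[OF pq(2)] u_def v_def ..
    have next_move: "u k + (v k - u k) / 3 \<le> p (Suc k)" "q (Suc k) \<le> v k - (v k - u k) / 3"
      "\<gamma> * ((v k - u k) / 3) \<le> q (Suc k) - p (Suc k)" for k
    proof -
      have "black_legal \<gamma> \<sigma> B (Suc k)" using legal by blast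
      then have sub: "{p (Suc k)..q (Suc k)} \<subseteq> {u k + (v k - u k) / 3 .. v k - (v k - u k) / 3}"
        and len: "\<gamma> * len (white_move \<sigma> B k) \<le> len (B (Suc k))"
        by (simp_all only: black_legal.simps pq(4) Wk)
      show "u k + (v k - u k) / 3 \<le> p (Suc k)" "q (Suc k) \<le> v k - (v k - u k) / 3"
        using sub pq(2)[of "Suc k"] by auto
      have "len (white_move \<sigma> B k) = (v k - u k) / 3"
        unfolding Wk using uv(2)[of k] by (simp add: field_simps)
      moreover have "len (B (Suc k)) = q (Suc k) - p (Suc k)"
        using pq(2)[of "Suc k"] unfolding pq(4) by simp
      ultimately show "\<gamma> * ((v k - u k) / 3) \<le> q (Suc k) - p (Suc k)"
        using len by (simp only:)
    qed
    show "(\<Inter>k. white_move \<sigma> B k) \<subseteq> orbit_avoiding (beta_map \<beta>) ?Z"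
    proof
      fix y assume "y \<in> (\<Inter>k. white_move \<sigma> B k)"
      then have yk: "u k + (v k - u k) / 3 \<le> y" "y \<le> v k - (v k - u k) / 3" for k
        unfolding Wk by auto
      show "y \<in> orbit_avoiding (beta_map \<beta>) ?Z"
      proof (rule escape_sequence_orbit_avoids[OF X shift c, of "c * \<gamma> / 3" u v p q n])
        show "0 < c * \<gamma> / 3" using c \<gamma> by simp
        fix k
        show "0 \<le> u k" "v k \<le> 1" using uv[of k] pq(1,3)[of k] by linarith+
        have "0 < (v k - u k) / 3" using uv(2)[of k] by simp
        then show "u k \<le> p (Suc k)" "q (Suc k) \<le> v k" using next_move(1,2)[of k] by linarith+
        have "c * (\<gamma> * ((v k - u k) / 3)) \<le> c * (q (Suc k) - p (Suc k))"
          using next_move(3) c by (intro mult_left_mono) auto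
        then show "c * \<gamma> / 3 * (v k - u k) \<le> v (Suc k) - u (Suc k)" using uv(4)[of "Suc k"] by simp
      qed (use E yk in auto)
    qed
  qed
  then show ?thesis unfolding winning_def by blast
qed

end

theorem proposition5:
  fixes \<beta> :: real and \<Sigma>\<^sub>A :: "(nat \<Rightarrow> nat) set" and w :: "nat list"
  assumes "\<beta> > 1"
    and "subshift_of_finite_type \<Sigma>\<^sub>A"
    and "\<Sigma>\<^sub>A \<subseteq> beta_shift \<beta>"
    and "w \<noteq> []"
    and "occurs_in w (beta_shift \<beta>)"
    and "\<not> occurs_in w \<Sigma>\<^sub>A"
  shows "\<exists>\<alpha>. 0 < \<alpha> \<and> \<alpha> < 1 \<and>
    winning \<alpha> (orbit_avoiding (beta_map \<beta>) (beta_value \<beta> ` \<Sigma>\<^sub>A))"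
proof -
  let ?Z = "beta_value \<beta> ` \<Sigma>\<^sub>A"
  note beta = assms(1) and sft = assms(2) and sub = assms(3)
  obtain a b where gap: "0 \<le> a" "a < b" "b \<le> 1" "{a<..<b} \<inter> ?Z = {}"
    using omitted_word_gives_gap[OF beta sub assms(5,6)] by blast
  have "\<exists>c>0. \<forall>p q. 0 \<le> p \<longrightarrow> p < q \<longrightarrow> q \<le> 1 \<longrightarrow> (\<exists>n u v. escape \<beta> c ?Z p q n u v)"
  proof (cases "\<exists>\<kappa>>0. {1 - \<kappa><..<1} \<inter> ?Z = {}")
    case True
    then show ?thesis using uniform_escape_away_from_one[OF beta gap] by blast
  next
    case False
    then have "quasi_digit \<beta> \<in> \<Sigma>\<^sub>A" by (intro quasi_digits_in_subshift[OF beta sub sft]) blast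
    then show ?thesis
      using quasi_orbit_bounded_below[OF beta sub sft]
        uniform_escape_quasi_orbit_bounded_below[OF beta gap] by blast
  qed
  then obtain c where c: "c > 0"
    and escapes: "\<And>p q. 0 \<le> p \<Longrightarrow> p < q \<Longrightarrow> q \<le> 1 \<Longrightarrow> \<exists>n u v. escape \<beta> c ?Z p q n u v"
    by blast
  obtain n u v where "escape \<beta> c ?Z 0 1 n u v" using escapes[of 0 1] by auto
  then have "c \<le> 1" by (simp add: escape_def)
  moreover have "winning (c / 3) (orbit_avoiding (beta_map \<beta>) ?Z)"
    using uniform_escape_imp_winning[OF beta sub subshift_shift_closed[OF sft] c escapes] .
  ultimately show ?thesis using c by (intro exI[of _ "c / 3"]) auto
qed

end
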